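(* Let $\mu_0=\sum_{i=1}^{N_0}a_i\delta_{x^{(i)}}\in\mathcal P(\mathbb R^{d_0})$ and $\mu_1=\sum_{j=1}^{N_1}b_j\delta_{y^{(j)}}\in\mathcal P(\mathbb R^{d_1})$ be finitely supported, $\varepsilon>0$, $M>M_{\mu_0,\mu_1}$, and $\Phi(A)=32\|A\|_F^2+\mathrm{OT}_{A,\varepsilon}(\mu_0,\mu_1)$. Assume that $\Phi$ is $L$-smooth on $\mathcal D_M$ and that, for every $A\in\mathcal D_M$, $\widetilde{\mathbf\Pi}^A$ is a $\delta$-oracle for $\mathbf\Pi^A$. Let $B^\star$ be a global minimizer of $\Phi$ and $\delta'=32M\delta\sum_{1\le i\le N_0,\,1\le j\le N_1}\|x^{(i)}\|\,\|y^{(j)}\|$. Then the iterates $A_k,B_k$ of the adaptive gradient method with inexact oracle (described in the context, started at $C_0\in\mathcal D_M$) satisfy: 1. If $\Phi$ is non-convex and $\mathrm{OT}_{(\cdot),\varepsilon}(\mu_0,\mu_1)$ is $L'$-smooth, then \[\min_{1\le i\le k}\left\|\beta_i^{-1}(B_i-A_i)\right\|_F^2\le\frac{96L^2}{k(k+1)(k+2)}\|C_0-B^\star\|_F^2+\frac{24LL'}{k}\left(\|B^\star\|_F^2+\frac{5M^2}{16}\right)+8L\delta'.\] 2. If $\Phi$ is convex, then \[\min_{1\le i\le k}\left\|\beta_i^{-1}(B_i-A_i)\right\|_F^2\le\frac{96L^2}{k(k+1)(k+2)}\|C_0-B^\star\|_F^2+8L\delta'.\]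
   Context: $\Pi(\mu_0,\mu_1)$ is the set of couplings; $\mathsf D_{\mathsf{KL}}$ is the Kullback–Leibler divergence; $\|\cdot\|_F$ is the Frobenius norm; $M_p(\mu)=\int\|x\|^pd\mu(x)$; $M_{\mu_0,\mu_1}=\sqrt{M_2(\mu_0)M_2(\mu_1)}$; $\mathcal D_M=\{A\in\mathbb R^{d_0\times d_1}:\|A\|_F\le M/2\}$. $c_A(x,y)=-4\|x\|^2\|y\|^2-32x^{\intercal}Ay$, $\mathrm{OT}_{A,\varepsilon}(\mu_0,\mu_1)=\inf_{\pi\in\Pi(\mu_0,\mu_1)}\int c_A\,d\pi+\varepsilon\mathsf D_{\mathsf{KL}}(\pi\|\mu_0\otimes\mu_1)$, $\pi^A$ is its unique optimal coupling and $\mathbf\Pi^A_{ij}=\pi^A(\{(x^{(i)},y^{(j)})\})$. A $\delta$-oracle for $\mathbf\Pi^A$ is a matrix $\widetilde{\mathbf\Pi}^A\in\mathbb R^{N_0\times N_1}$ with $\|\widetilde{\mathbf\Pi}^A-\mathbf\Pi^A\|_\infty<\delta$ (entrywise maximum). A function is $L$-smooth (on a set) if its gradient is $L$-Lipschitz (on that set) for the Frobenius norm. Approximate gradient: $\widetilde D\Phi_{[A]}=64A-32\sum_{i,j}x^{(i)}(y^{(j)})^{\intercal}\widetilde{\mathbf\Pi}^A_{ij}$. Adaptive gradient method with inexact oracle: given $C_0\in\mathcal D_M$, fix $\beta_k=\frac1{2L}$, $\gamma_k=\frac k{4L}$, $\tau_k=\frac2{k+2}$. Initialize $A_1=C_0$,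 $G_1=\widetilde D\Phi_{[A_1]}$. For $k=1,2,\dots$: $B_k=\min\left(1,\frac{M}{2\|A_k-\beta_kG_k\|_F}\right)(A_k-\beta_kG_k)$; $C_k=\min\left(1,\frac{M}{2\|C_{k-1}-\gamma_kG_k\|_F}\right)(C_{k-1}-\gamma_kG_k)$; $A_{k+1}=\tau_kC_k+(1-\tau_k)B_k$; $G_{k+1}=\widetilde D\Phi_{[A_{k+1}]}$; with the convention $\min(1,M/0)=1$. *)

theory Defs
  imports "HOL-Probability.Probability"
begin

text \<open>Matrices with rows indexed by \<open>'m\<close> and columns by \<open>'n\<close> have type \<open>real ^ 'n ^ 'm\<close>.
  The library's \<open>norm\<close> and \<open>inner\<close> on this type are the Frobenius norm and inner product, and
  \<open>infnorm\<close> is the largest absolute value of an entry.\<close>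

definition outer_product :: "real ^ 'm \<Rightarrow> real ^ 'n \<Rightarrow> real ^ 'n ^ 'm" where
  "outer_product u v = (\<chi> p q. u $ p * v $ q)"

definition discrete_measure :: "('n::finite \<Rightarrow> real) \<Rightarrow> ('n \<Rightarrow> 'a::topological_space) \<Rightarrow> 'a measure" where
  "discrete_measure a x = distr (point_measure UNIV (\<lambda>i. ennreal (a i))) borel x"

lemma sets_discrete_measure [simp]: "sets (discrete_measure a x) = sets borel"
  and space_discrete_measure [simp]: "space (discrete_measure a x) = UNIV"
  by (simp_all add: discrete_measure_def)

lemma emeasure_discrete_measure:
  assumes "S \<in> sets borel"
  shows "emeasure (discrete_measure a x) S = (\<Sum>i\<in>UNIV. ennreal (a i) * indicator S (x i))"
proof -
  have "emeasure (discrete_measure a x) S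
      = emeasure (point_measure UNIV (\<lambda>i. ennreal (a i))) (x -` S \<inter> UNIV)"
    unfolding discrete_measure_def using assms
    by (subst emeasure_distr) (auto simp: measurable_point_measure_eq1 space_point_measure)
  also have "\<dots> = (\<Sum>i\<in>x -` S \<inter> UNIV. ennreal (a i))"
    by (rule emeasure_point_measure_finite2) auto
  also have "\<dots> = (\<Sum>i\<in>UNIV. ennreal (a i) * indicator S (x i))"
    by (intro sum.mono_neutral_cong_left) auto
  finally show ?thesis .
qed

definition moment :: "nat \<Rightarrow> 'a::real_normed_vector measure \<Rightarrow> real" where
  "moment p \<mu> = (\<integral>x. norm x ^ p \<partial>\<mu>)"

definition moment_const ::
    "'a::real_normed_vector measure \<Rightarrow> 'b::real_normed_vector measure \<Rightarrow> real" where
  "moment_const \<mu> \<nu> = sqrt (moment 2 \<mu> * moment 2 \<nu>)"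

definition couplings :: "'a measure \<Rightarrow> 'b measure \<Rightarrow> ('a \<times> 'b) measure set" where
  "couplings \<mu> \<nu> = {\<pi>. prob_space \<pi> \<and> sets \<pi> = sets (\<mu> \<Otimes>\<^sub>M \<nu>) \<and>
     distr \<pi> \<mu> fst = \<mu> \<and> distr \<pi> \<nu> snd = \<nu>}"

text \<open>The library's \<open>KL_divergence\<close> is real-valued, takes the reference measure first, and carries
  no information when its integrand is undefined or not integrable. For probability measures with
  \<open>\<pi> \<lless> \<rho>\<close> the negative part of the log-density is always \<open>\<pi>\<close>-integrable, so
  non-integrability means that the divergence is infinite.\<close>

definition KL :: "'a measure \<Rightarrow> 'a measure \<Rightarrow> ereal" where
  "KL \<pi> \<rho> = (if absolutely_continuous \<rho> \<pi> \<and> integrable \<pi> (entropy_density (exp 1) \<rho> \<pi>)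
             then ereal (KL_divergence (exp 1) \<rho> \<pi>) else \<infinity>)"

definition cost :: "real ^ 'd1 ^ 'd0 \<Rightarrow> real ^ 'd0 \<Rightarrow> real ^ 'd1 \<Rightarrow> real" where
  "cost A x y = - 4 * (norm x)\<^sup>2 * (norm y)\<^sup>2 - 32 * (x \<bullet> (A *v y))"

definition eot_objective :: "real ^ 'd1 ^ 'd0 \<Rightarrow> real \<Rightarrow> (real ^ 'd0) measure \<Rightarrow> (real ^ 'd1) measure \<Rightarrow>
    ((real ^ 'd0) \<times> (real ^ 'd1)) measure \<Rightarrow> ereal" where
  "eot_objective A \<epsilon> \<mu> \<nu> \<pi> = ereal (\<integral>(x, y). cost A x y \<partial>\<pi>) + ereal \<epsilon> * KL \<pi> (\<mu> \<Otimes>\<^sub>M \<nu>)"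

definition EOT :: "real ^ 'd1 ^ 'd0 \<Rightarrow> real \<Rightarrow> (real ^ 'd0) measure \<Rightarrow> (real ^ 'd1) measure \<Rightarrow> real" where
  "EOT A \<epsilon> \<mu> \<nu> = real_of_ereal (INF \<pi>\<in>couplings \<mu> \<nu>. eot_objective A \<epsilon> \<mu> \<nu> \<pi>)"

definition optimal_coupling :: "real ^ 'd1 ^ 'd0 \<Rightarrow> real \<Rightarrow> (real ^ 'd0) measure \<Rightarrow>
    (real ^ 'd1) measure \<Rightarrow> ((real ^ 'd0) \<times> (real ^ 'd1)) measure" where
  "optimal_coupling A \<epsilon> \<mu> \<nu> =
     (THE \<pi>. is_arg_min (eot_objective A \<epsilon> \<mu> \<nu>) (\<lambda>\<pi>. \<pi> \<in> couplings \<mu> \<nu>) \<pi>)"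

definition coupling_matrix :: "('n0::finite \<Rightarrow> real ^ 'd0) \<Rightarrow> ('n1::finite \<Rightarrow> real ^ 'd1) \<Rightarrow>
    ((real ^ 'd0) \<times> (real ^ 'd1)) measure \<Rightarrow> real ^ 'n1 ^ 'n0" where
  "coupling_matrix x y \<pi> = (\<chi> i j. measure \<pi> {(x i, y j)})"

definition delta_oracle :: "real \<Rightarrow> real ^ 'n1 ^ 'n0 \<Rightarrow> real ^ 'n1 ^ 'n0 \<Rightarrow> bool" where
  "delta_oracle \<delta> P\<^sub>t P \<longleftrightarrow> infnorm (P\<^sub>t - P) < \<delta>"

definition L_smooth_on :: "real \<Rightarrow> 'a::real_inner set \<Rightarrow> ('a \<Rightarrow> real) \<Rightarrow> bool" where
  "L_smooth_on L S f \<longleftrightarrow> (\<exists>g. (\<forall>A\<in>S. GDERIV f A :> g A) \<and> L-lipschitz_on S g)"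

definition matrix_ball :: "real \<Rightarrow> (real ^ 'd1 ^ 'd0) set" where
  "matrix_ball M = {A. norm A \<le> M / 2}"

definition approx_gradient :: "('n0::finite \<Rightarrow> real ^ 'd0) \<Rightarrow> ('n1::finite \<Rightarrow> real ^ 'd1) \<Rightarrow>
    real ^ 'n1 ^ 'n0 \<Rightarrow> real ^ 'd1 ^ 'd0 \<Rightarrow> real ^ 'd1 ^ 'd0" where
  "approx_gradient x y P\<^sub>t A =
     64 *\<^sub>R A - 32 *\<^sub>R (\<Sum>i\<in>UNIV. \<Sum>j\<in>UNIV. P\<^sub>t $ i $ j *\<^sub>R outer_product (x i) (y j))"

text \<open>The case distinction implements the convention \<open>min (1, M/0) = 1\<close>, since \<open>M / 0 = 0\<close> in HOL.\<close>

definition truncate_norm :: "real \<Rightarrow> 'a::real_normed_vector \<Rightarrow> 'a" where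
  "truncate_norm M A = (if A = 0 then 1 else min 1 (M / (2 * norm A))) *\<^sub>R A"

definition step_beta :: "real \<Rightarrow> nat \<Rightarrow> real" where
  "step_beta L k = 1 / (2 * L)"

definition step_gamma :: "real \<Rightarrow> nat \<Rightarrow> real" where
  "step_gamma L k = real k / (4 * L)"

definition step_tau :: "nat \<Rightarrow> real" where
  "step_tau k = 2 / (real k + 2)"

text \<open>\<open>D\<close> is the gradient oracle. The sequences \<open>A\<close>, \<open>B\<close>, \<open>G\<close> start at index 1 (their values at
  index 0 are irrelevant), and \<open>C\<close> starts at index 0.\<close>

definition adaptive_gradient_run :: "real \<Rightarrow> real \<Rightarrow> ('a \<Rightarrow> 'a) \<Rightarrow>
    (nat \<Rightarrow> 'a::real_normed_vector) \<Rightarrow> (nat \<Rightarrow> 'a) \<Rightarrow> (nat \<Rightarrow> 'a) \<Rightarrow> (nat \<Rightarrow> 'a) \<Rightarrow> bool" where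
  "adaptive_gradient_run M L D A B C G \<longleftrightarrow>
     A 1 = C 0 \<and> G 1 = D (A 1) \<and>
     (\<forall>k\<ge>1.
        B k = truncate_norm M (A k - step_beta L k *\<^sub>R G k) \<and>
        C k = truncate_norm M (C (k - 1) - step_gamma L k *\<^sub>R G k) \<and>
        A (k + 1) = step_tau k *\<^sub>R C k + (1 - step_tau k) *\<^sub>R B k \<and>
        G (k + 1) = D (A (k + 1)))"

end

(*
  Danskin plus accelerated descent. For finitely supported marginals a coupling is a matrix in a
  compact polytope and the regularised cost is continuous and strictly convex there, so the optimal
  plan exists and is unique. As a function of A the transport value is an infimum of affine
  functions, so the optimal plan at A provides a supergradient. Consequently, wherever Phi is
  differentiable, its gradient is 64 A - 32 sum_ij x_i y_j^T Pi^A_ij, and a global minimiser B* equals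
  half of sum_ij x_i y_j^T Pi^{B*}_ij, which by Cauchy-Schwarz lies in D_M.

  Each step of the method combines the descent lemma, the variational inequalities of the two
  projections onto D_M (the truncations), and a lower quadratic bound
  Phi(v) >= Phi(u) + <grad Phi(u), v - u> - l/2 |v - u|^2, where l = 0 if Phi is convex and
  l = L' otherwise. Weighting step k by k(k+1)/2 makes the resulting inequalities telescope.
*)
theory Submission
  imports Defs "HOL-Real_Asymp.Real_Asymp"
begin

subsection \<open>Projected accelerated descent\<close>

lemma truncate_norm_in_cball:
  assumes "M > 0" shows "norm (truncate_norm M X) \<le> M / 2"
proof (cases "X = 0")
  case False
  then have "norm (truncate_norm M X) = min 1 (M / (2 * norm X)) * norm X"
    using assms by (simp add: truncate_norm_def)
  also have "\<dots> \<le> (M / (2 * norm X)) * norm X"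
    by (intro mult_right_mono) auto
  finally show ?thesis using False by simp
qed (use assms in \<open>simp add: truncate_norm_def\<close>)

text \<open>The obtuse-angle property of the projection onto the ball. Outside the ball the
  displacement is a positive multiple of \<open>X\<close>, and by Cauchy-Schwarz no point of the
  ball has a larger inner product with \<open>X\<close> than \<open>t *\<^sub>R X\<close>.\<close>

lemma truncate_norm_variational:
  fixes X u :: "'a::real_inner"
  assumes "M > 0" "norm u \<le> M / 2"
  shows "(X - truncate_norm M X) \<bullet> (u - truncate_norm M X) \<le> 0"
proof (cases "norm X \<le> M / 2")
  case True
  then have "X = 0 \<or> M / (2 * norm X) \<ge> 1" by (cases "X = 0") (auto simp: pos_le_divide_eq)
  then have "truncate_norm M X = X" by (auto simp: truncate_norm_def)
  then show ?thesis by simp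
next
  case False
  then have X: "X \<noteq> 0" "norm X > 0" using assms by auto
  define t where "t = M / (2 * norm X)"
  have t: "t < 1" "t * norm X = M / 2" using False X by (auto simp: t_def field_simps)
  then have P: "truncate_norm M X = t *\<^sub>R X" using X by (simp add: truncate_norm_def t_def)
  have "X \<bullet> u \<le> norm X * norm u" by (rule norm_cauchy_schwarz)
  also have "\<dots> \<le> norm X * (t * norm X)" using assms t by (intro mult_left_mono) auto
  also have "\<dots> = X \<bullet> (t *\<^sub>R X)" by (simp add: dot_square_norm power2_eq_square)
  finally have "X \<bullet> (u - t *\<^sub>R X) \<le> 0" by (simp add: inner_diff_right)
  then have "(1 - t) * (X \<bullet> (u - t *\<^sub>R X)) \<le> 0" using t by (simp add: mult_le_0_iff)
  also have "(1 - t) * (X \<bullet> (u - t *\<^sub>R X)) = (X - t *\<^sub>R X) \<bullet> (u - t *\<^sub>R X)"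
    by (simp add: inner_diff_left algebra_simps)
  finally show ?thesis by (simp add: P)
qed

text \<open>Polarization turns the variational inequality at \<open>X - \<beta> *\<^sub>R G\<close>
  into differences of squared distances.\<close>

lemma truncate_norm_three_point:
  fixes X G u :: "'a::real_inner"
  assumes "M > 0" "norm u \<le> M / 2" "\<beta> > 0"
  defines "B \<equiv> truncate_norm M (X - \<beta> *\<^sub>R G)"
  shows "G \<bullet> (B - u) \<le> ((norm (X - u))\<^sup>2 - (norm (B - u))\<^sup>2 - (norm (B - X))\<^sup>2) / (2 * \<beta>)"
proof -
  have "((X - \<beta> *\<^sub>R G) - B) \<bullet> (u - B) \<le> 0"
    unfolding B_def using assms by (intro truncate_norm_variational) auto
  then have "2 * \<beta> * (G \<bullet> (B - u)) \<le> (norm (X - u))\<^sup>2 - (norm (B - u))\<^sup>2 - (norm (B - X))\<^sup>2"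
    by (simp add: power2_norm_eq_inner inner_simps inner_commute algebra_simps)
  then show ?thesis using assms by (simp add: field_simps)
qed

section \<open>Quadratic bounds from smoothness and convexity\<close>

lemma gderiv_line:
  fixes f :: "'a::real_inner \<Rightarrow> real"
  assumes "GDERIV f (x + t *\<^sub>R d) :> D"
  shows "((\<lambda>s. f (x + s *\<^sub>R d)) has_real_derivative d \<bullet> D) (at t)"
proof -
  have "((\<lambda>s. f (x + s *\<^sub>R d)) has_derivative (\<lambda>h. (h *\<^sub>R d) \<bullet> D)) (at t)"
    by (rule has_derivative_compose[where f = "\<lambda>s. x + s *\<^sub>R d" and g = f])
       (use assms in \<open>auto simp: gderiv_def intro!: derivative_eq_intros\<close>)
  then show ?thesis by (simp add: has_field_derivative_def mult.commute[of _ "d \<bullet> D"])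
qed

text \<open>The auxiliary \<open>\<phi>\<close> is \<open>f\<close> on the segment minus the linear
  and quadratic terms of the bound. Cauchy-Schwarz and the Lipschitz condition make its derivative
  nonpositive on [0, 1].\<close>

lemma descent_lemma:
  fixes f :: "'a::real_inner \<Rightarrow> real"
  assumes "convex S" "\<And>z. z \<in> S \<Longrightarrow> GDERIV f z :> g z" "L-lipschitz_on S g"
    and xy: "x \<in> S" "y \<in> S"
  shows "f y \<le> f x + g x \<bullet> (y - x) + L / 2 * (norm (y - x))\<^sup>2"
proof -
  define d where "d = y - x"
  define \<phi> where "\<phi> t = f (x + t *\<^sub>R d) - t * (g x \<bullet> d) - L / 2 * t\<^sup>2 * (norm d)\<^sup>2" for t
  have "\<phi> 1 \<le> \<phi> 0"
  proof (rule DERIV_nonpos_imp_nonincreasing[of 0 1 \<phi>])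
    fix t :: real assume t: "0 \<le> t" "t \<le> 1"
    have z: "x + t *\<^sub>R d \<in> S"
      using convexD_alt[OF assms(1) xy, of t] t by (simp add: d_def algebra_simps)
    have "(\<phi> has_real_derivative d \<bullet> g (x + t *\<^sub>R d) - g x \<bullet> d - L * t * (norm d)\<^sup>2) (at t)"
      unfolding \<phi>_def
      by (rule derivative_eq_intros gderiv_line assms(2)[OF z] refl | simp)+
    moreover have "d \<bullet> g (x + t *\<^sub>R d) - g x \<bullet> d \<le> L * t * (norm d)\<^sup>2"
    proof -
      have "d \<bullet> g (x + t *\<^sub>R d) - g x \<bullet> d = d \<bullet> (g (x + t *\<^sub>R d) - g x)"
        by (simp add: inner_diff_right inner_commute)
      also have "\<dots> \<le> norm d * norm (g (x + t *\<^sub>R d) - g x)" by (rule norm_cauchy_schwarz)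
      also have "\<dots> \<le> norm d * (L * (t * norm d))"
        using lipschitz_onD[OF assms(3) z xy(1)] t by (intro mult_left_mono) (simp_all add: dist_norm)
      finally show ?thesis by (simp add: power2_eq_square mult_ac)
    qed
    ultimately show "\<exists>D. (\<phi> has_real_derivative D) (at t) \<and> D \<le> 0" by force
  qed simp
  then show ?thesis by (simp add: \<phi>_def d_def algebra_simps)
qed

lemma descent_lemma_lower:
  fixes f :: "'a::real_inner \<Rightarrow> real"
  assumes "convex S" "\<And>z. z \<in> S \<Longrightarrow> GDERIV f z :> g z" "L-lipschitz_on S g" "x \<in> S" "y \<in> S"
  shows "f x + g x \<bullet> (y - x) - L / 2 * (norm (y - x))\<^sup>2 \<le> f y"
  using descent_lemma[of S "\<lambda>z. - f z" "\<lambda>z. - g z" L x y] assms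
  by (simp add: GDERIV_minus lipschitz_on_def)

text \<open>Serves to identify gradients: a supergradient inequality makes an auxiliary function
  maximal at the point of interest, so its gradient vanishes there.\<close>

lemma gderiv_local_max:
  fixes f :: "'a::real_inner \<Rightarrow> real"
  assumes "GDERIV f x :> D" "\<And>y. f y \<le> f x"
  shows "D = 0"
proof -
  have "(\<lambda>h. h \<bullet> D) = (\<lambda>h. 0)"
    using assms(2) by (intro has_derivative_local_max[OF assms(1)[unfolded gderiv_def]]) simp
  then show ?thesis by (metis inner_eq_zero_iff)
qed

text \<open>Convexity bounds the difference quotients from \<open>x\<close> towards \<open>y\<close>
  by \<open>f y - f x\<close>; the bound survives the limit \<open>t\<close> to 0 from the
  right.\<close>

lemma convex_on_imp_above_gradient:
  fixes f :: "'a::real_inner \<Rightarrow> real"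
  assumes "convex_on UNIV f" "GDERIV f x :> D"
  shows "f x + D \<bullet> (y - x) \<le> f y"
proof -
  have "((\<lambda>t. f (x + t *\<^sub>R (y - x))) has_real_derivative (y - x) \<bullet> D) (at 0)"
    using assms(2) by (intro gderiv_line) simp
  then have "((\<lambda>t. (f (x + t *\<^sub>R (y - x)) - f x) / t) \<longlongrightarrow> (y - x) \<bullet> D) (at_right 0)"
    by (auto simp: has_field_derivative_iff intro: tendsto_mono[OF at_le])
  moreover have "\<forall>\<^sub>F t in at_right 0. (f (x + t *\<^sub>R (y - x)) - f x) / t \<le> f y - f x"
    unfolding eventually_at_right_field
  proof (intro exI[of _ 1] conjI allI impI)
    fix t :: real assume t: "0 < t" "t < 1"
    have "f ((1 - t) *\<^sub>R x + t *\<^sub>R y) \<le> (1 - t) * f x + t * f y"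
      using t by (intro convex_onD[OF assms(1)]) auto
    then show "(f (x + t *\<^sub>R (y - x)) - f x) / t \<le> f y - f x"
      using t by (simp add: pos_divide_le_eq) (simp add: algebra_simps)
  qed simp
  ultimately have "(y - x) \<bullet> D \<le> f y - f x"
    by (intro tendsto_upperbound) auto
  then show ?thesis by (simp add: inner_commute)
qed

section \<open>The accelerated method with an inexact gradient\<close>

text \<open>The exact gradient \<open>g\<close> enters only through two quadratic bounds, and
  \<open>D\<close> is the oracle. The ball has diameter \<open>M\<close>, so \<open>\<eta>\<close>
  bounds the oracle error tested against any difference of two points of the ball. The parameter
  \<open>l\<close> lets one argument serve the convex case (\<open>l = 0\<close>) and the non-convex
  case.\<close>

locale inexact_run =
  fixes f :: "'a::real_inner \<Rightarrow> real" and g D :: "'a \<Rightarrow> 'a" and A B C G :: "nat \<Rightarrow> 'a"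
    and Bs :: 'a and M L l \<eta> :: real
  assumes M: "M > 0" and L: "L > 0" and l: "l \<ge> 0"
    and upper: "\<And>u v. norm u \<le> M / 2 \<Longrightarrow> norm v \<le> M / 2 \<Longrightarrow>
      f v \<le> f u + g u \<bullet> (v - u) + L / 2 * (norm (v - u))\<^sup>2"
    and lower: "\<And>u v. norm u \<le> M / 2 \<Longrightarrow> norm v \<le> M / 2 \<Longrightarrow>
      f u + g u \<bullet> (v - u) - l / 2 * (norm (v - u))\<^sup>2 \<le> f v"
    and err: "\<And>u. norm u \<le> M / 2 \<Longrightarrow> norm (D u - g u) * M \<le> \<eta>"
    and Bs: "norm Bs \<le> M / 2" and min: "\<And>u. f Bs \<le> f u"
    and C0: "norm (C 0) \<le> M / 2"
    and run: "adaptive_gradient_run M L D A B C G"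
begin

lemma norm_B: "k \<ge> 1 \<Longrightarrow> norm (B k) \<le> M / 2"
  and norm_C: "norm (C k) \<le> M / 2"
proof -
  show "k \<ge> 1 \<Longrightarrow> norm (B k) \<le> M / 2"
    using run truncate_norm_in_cball[OF M] unfolding adaptive_gradient_run_def by metis
  show "norm (C k) \<le> M / 2"
    using run C0 truncate_norm_in_cball[OF M] unfolding adaptive_gradient_run_def
    by (metis less_one not_le)
qed

text \<open>Here \<open>\<alpha>\<close> is \<open>step_tau (k - 1)\<close> and \<open>b\<close> is
  the point mixed with \<open>C (k - 1)\<close> to form \<open>A k\<close>. Keeping \<open>b\<close>
  free covers \<open>k = 1\<close>, where \<open>\<alpha> = 1\<close> and the run determines no
  earlier \<open>B\<close>.\<close>

lemma one_step:
  fixes k :: nat and b :: 'a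
  assumes k: "k \<ge> 1" and b: "norm b \<le> M / 2" and A: "A k = \<alpha> *\<^sub>R C (k - 1) + (1 - \<alpha>) *\<^sub>R b"
    and \<alpha>: "\<alpha> = 2 / (real k + 1)" and G: "G k = D (A k)"
  shows "f (B k) - f Bs \<le> (1 - \<alpha>) * (f b - f Bs)
     + 4 * L / (real k * (real k + 1)) * ((norm (C (k - 1) - Bs))\<^sup>2 - (norm (C k - Bs))\<^sup>2)
     - L / 2 * (norm (B k - A k))\<^sup>2 + \<eta>
     + l / 2 * ((1 - \<alpha>) * (norm (b - A k))\<^sup>2 + \<alpha> * (norm (Bs - A k))\<^sup>2)"
proof -
  have \<alpha>01: "0 < \<alpha>" "\<alpha> \<le> 1" using k by (auto simp: \<alpha> field_simps)
  have conv: "norm (\<alpha> *\<^sub>R u + (1 - \<alpha>) *\<^sub>R v) \<le> M / 2" if "norm u \<le> M / 2" "norm v \<le> M / 2" for u v :: 'a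
    using convexD_alt[OF convex_cball[of 0 "M / 2"], of v u \<alpha>] that \<alpha>01
    by (simp add: add.commute)
  \<comment> \<open>The comparison point \<open>z\<close> mixes \<open>b\<close> with the minimiser,
    and \<open>u\<close> has \<open>C k\<close> in its place. Hence
    \<open>A k - u = \<alpha> *\<^sub>R (C (k - 1) - C k)\<close> and
    \<open>u - z = \<alpha> *\<^sub>R (C k - Bs)\<close>, which links the two projections.\<close>
  define z where "z = (1 - \<alpha>) *\<^sub>R b + \<alpha> *\<^sub>R Bs"
  define u where "u = \<alpha> *\<^sub>R C k + (1 - \<alpha>) *\<^sub>R b"
  have nA: "norm (A k) \<le> M / 2" unfolding A by (intro conv norm_C b)
  have nu: "norm u \<le> M / 2" unfolding u_def by (intro conv norm_C b)
  have nz: "norm z \<le> M / 2" unfolding z_def using conv[OF Bs b] by (simp add: add.commute)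
  have nB: "norm (B k) \<le> M / 2" using k by (rule norm_B)
  have Bk: "B k = truncate_norm M (A k - (1 / (2 * L)) *\<^sub>R G k)"
    and Ck: "C k = truncate_norm M (C (k - 1) - (real k / (4 * L)) *\<^sub>R G k)"
    using run k by (auto simp: adaptive_gradient_run_def step_beta_def step_gamma_def)
  have pB: "G k \<bullet> (B k - u) \<le> L * ((norm (A k - u))\<^sup>2 - (norm (B k - A k))\<^sup>2)"
  proof -
    have "G k \<bullet> (B k - u) \<le> L * ((norm (A k - u))\<^sup>2 - (norm (B k - u))\<^sup>2 - (norm (B k - A k))\<^sup>2)"
      using truncate_norm_three_point[OF M nu, where \<beta> = "1 / (2 * L)" and X = "A k" and G = "G k",
          folded Bk] L
      by (simp add: mult.commute)
    also have "\<dots> \<le> L * ((norm (A k - u))\<^sup>2 - (norm (B k - A k))\<^sup>2)"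
      using L by (intro mult_left_mono) auto
    finally show ?thesis .
  qed
  have Au: "(norm (A k - u))\<^sup>2 = \<alpha>\<^sup>2 * (norm (C k - C (k - 1)))\<^sup>2"
  proof -
    have "A k - u = \<alpha> *\<^sub>R (C (k - 1) - C k)" by (simp add: A u_def algebra_simps)
    then show ?thesis by (simp add: power_mult_distrib norm_minus_commute)
  qed
  \<comment> \<open>This is \<open>1 / (2 * step_gamma L k)\<close>, the factor in the three-point
    inequality for \<open>C k\<close>.\<close>
  define p where "p = 2 * L / real k"
  have p: "p > 0" using L k by (simp add: p_def)
  have pC: "G k \<bullet> (C k - Bs) \<le> p * ((norm (C (k - 1) - Bs))\<^sup>2
      - (norm (C k - Bs))\<^sup>2 - (norm (C k - C (k - 1)))\<^sup>2)"
    using truncate_norm_three_point[OF M Bs, where \<beta> = "real k / (4 * L)" and X = "C (k - 1)" and G = "G k",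
        folded Ck] L k
    by (simp add: p_def mult.commute)
  have "G k \<bullet> (B k - z) = G k \<bullet> (B k - u) + \<alpha> * (G k \<bullet> (C k - Bs))"
    by (simp add: u_def z_def inner_simps algebra_simps)
  also have "\<dots> \<le> L * (\<alpha>\<^sup>2 * (norm (C k - C (k - 1)))\<^sup>2 - (norm (B k - A k))\<^sup>2)
      + \<alpha> * (p * ((norm (C (k - 1) - Bs))\<^sup>2
      - (norm (C k - Bs))\<^sup>2 - (norm (C k - C (k - 1)))\<^sup>2))"
    using pB pC \<alpha>01 unfolding Au by (intro add_mono mult_left_mono) auto
  also have "\<dots> = \<alpha> * p * ((norm (C (k - 1) - Bs))\<^sup>2 - (norm (C k - Bs))\<^sup>2)
      - L * (norm (B k - A k))\<^sup>2 - \<alpha> * (p - L * \<alpha>) * (norm (C k - C (k - 1)))\<^sup>2"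
    by (simp add: algebra_simps power2_eq_square)
  also have "\<dots> \<le> \<alpha> * p * ((norm (C (k - 1) - Bs))\<^sup>2 - (norm (C k - Bs))\<^sup>2)
      - L * (norm (B k - A k))\<^sup>2"
  proof -
    \<comment> \<open>The step sizes are matched here:
      \<open>2 * L / (k + 1) \<le> 2 * L / k\<close> lets the negative movement term of the
      \<open>C\<close> projection absorb the positive one of the \<open>B\<close>
      projection.\<close>
    have "L * \<alpha> \<le> p" using k L by (simp add: \<alpha> p_def field_simps)
    then show ?thesis using \<alpha>01 by simp
  qed
  finally have GB: "G k \<bullet> (B k - z) \<le> \<alpha> * p * ((norm (C (k - 1) - Bs))\<^sup>2 - (norm (C k - Bs))\<^sup>2)
      - L * (norm (B k - A k))\<^sup>2" .
  have e: "(g (A k) - G k) \<bullet> (B k - z) \<le> \<eta>"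
  proof -
    have "(g (A k) - G k) \<bullet> (B k - z) \<le> norm (g (A k) - G k) * norm (B k - z)"
      by (rule norm_cauchy_schwarz)
    also have "\<dots> \<le> norm (g (A k) - G k) * M"
      using norm_triangle_ineq4[of "B k" z] nB nz by (intro mult_left_mono) auto
    also have "\<dots> \<le> \<eta>" using err[OF nA] by (simp add: G norm_minus_commute)
    finally show ?thesis .
  qed
  \<comment> \<open>Descent bound at \<open>B k\<close>, then lower bounds at \<open>b\<close> and
    \<open>Bs\<close> with weights \<open>1 - \<alpha>\<close> and \<open>\<alpha>\<close>. The
    gradient terms combine to \<open>g (A k) \<bullet> (B k - z)\<close>, and \<open>- L\<close>
    from \<open>GB\<close> against \<open>L / 2\<close> here leaves \<open>- L / 2\<close>.\<close>
  have 1: "f (B k) \<le> f (A k) + g (A k) \<bullet> (B k - A k) + L / 2 * (norm (B k - A k))\<^sup>2"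
    by (rule upper[OF nA nB])
  have 2: "(1 - \<alpha>) * (f (A k) + g (A k) \<bullet> (b - A k) - l / 2 * (norm (b - A k))\<^sup>2) \<le> (1 - \<alpha>) * f b"
    using \<alpha>01 by (intro mult_left_mono lower nA b) auto
  have 3: "\<alpha> * (f (A k) + g (A k) \<bullet> (Bs - A k) - l / 2 * (norm (Bs - A k))\<^sup>2) \<le> \<alpha> * f Bs"
    using \<alpha>01 by (intro mult_left_mono lower nA Bs) auto
  have 4: "g (A k) \<bullet> (B k - z) = g (A k) \<bullet> (B k - A k)
      - (1 - \<alpha>) * (g (A k) \<bullet> (b - A k)) - \<alpha> * (g (A k) \<bullet> (Bs - A k))"
    by (simp add: z_def inner_simps algebra_simps)
  define c where "c = 4 * L / (real k * (real k + 1))"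
  have c: "\<alpha> * p = c"
    by (simp add: \<alpha> p_def c_def)
  show ?thesis
    using 1 2 3 4 GB[unfolded c] e unfolding c_def[symmetric] by (simp add: inner_diff_left field_simps)
qed

definition W :: real where "W = (norm Bs)\<^sup>2 + 5 * M\<^sup>2 / 16"

text \<open>The weights \<open>k * (k + 1) / 2\<close> are the reciprocals of \<open>\<Prod>i=2..k. 1 - 2 / (i + 1)\<close>,
  which makes the recursion telescope.\<close>

definition V :: "nat \<Rightarrow> real" where
  "V k = real k * (real k + 1) / 2 * (f (B k) - f Bs) + 2 * L * (norm (C k - Bs))\<^sup>2"

text \<open>This is \<open>one_step\<close> multiplied by \<open>(n + 1) * (n + 2) / 2\<close>: the
  gap at \<open>B n\<close> receives the weight it has in \<open>V n\<close>, and the distances to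
  \<open>Bs\<close> receive the constant weight \<open>2 * L\<close>.\<close>

lemma V_Suc:
  "V (Suc n) + L / 4 * (real n + 1) * (real n + 2) * (norm (B (Suc n) - A (Suc n)))\<^sup>2
    \<le> V n + \<eta> * (real n + 1) * (real n + 2) / 2 + l * (real n + 2) * W"
proof -
  define \<alpha> where "\<alpha> = 2 / (real n + 2)"
  \<comment> \<open>\<open>B 0\<close> is an arbitrary value, so \<open>C 0\<close> stands in for
    it. For \<open>n = 0\<close> both \<open>1 - \<alpha>\<close> and the weight of the gap in
    \<open>V 0\<close> vanish.\<close>
  define b where "b = (if n = 0 then C 0 else B n)"
  have b: "norm b \<le> M / 2" unfolding b_def using C0 norm_B[of n] by auto
  have \<alpha>': "0 < \<alpha>" "\<alpha> \<le> 1" by (auto simp: \<alpha>_def field_simps)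
  have A: "A (Suc n) = \<alpha> *\<^sub>R C n + (1 - \<alpha>) *\<^sub>R b"
    using run by (cases "n = 0") (auto simp: adaptive_gradient_run_def \<alpha>_def b_def step_tau_def)
  have G: "G (Suc n) = D (A (Suc n))"
    using run by (cases "n = 0") (auto simp: adaptive_gradient_run_def)
  define q where "q = (real n + 1) * (real n + 2)"
  have q: "q > 0" by (simp add: q_def)
  define r where "r = (1 - \<alpha>) * (norm (b - A (Suc n)))\<^sup>2 + \<alpha> * (norm (Bs - A (Suc n)))\<^sup>2"
  have step: "f (B (Suc n)) - f Bs \<le> (1 - \<alpha>) * (f b - f Bs)
     + 4 * L / q * ((norm (C n - Bs))\<^sup>2 - (norm (C (Suc n) - Bs))\<^sup>2)
     - L / 2 * (norm (B (Suc n) - A (Suc n)))\<^sup>2 + \<eta> + l / 2 * r"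
    using one_step[of "Suc n" b \<alpha>, OF _ b _ _ G] A by (simp add: \<alpha>_def q_def r_def add.commute)
  have "q / 2 * (f (B (Suc n)) - f Bs) \<le> q / 2 * ((1 - \<alpha>) * (f b - f Bs)
     + 4 * L / q * ((norm (C n - Bs))\<^sup>2 - (norm (C (Suc n) - Bs))\<^sup>2)
     - L / 2 * (norm (B (Suc n) - A (Suc n)))\<^sup>2 + \<eta> + l / 2 * r)"
    using q by (intro mult_left_mono step) auto
  also have "\<dots> = q / 2 * (1 - \<alpha>) * (f b - f Bs)
     + 2 * L * ((norm (C n - Bs))\<^sup>2 - (norm (C (Suc n) - Bs))\<^sup>2)
     - L / 4 * q * (norm (B (Suc n) - A (Suc n)))\<^sup>2 + \<eta> * q / 2 + l / 2 * (q / 2 * r)"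
    using q by (simp add: field_simps)
  also have "q / 2 * (1 - \<alpha>) = real n * (real n + 1) / 2"
    by (simp add: q_def \<alpha>_def field_simps)
  also have "real n * (real n + 1) / 2 * (f b - f Bs) = real n * (real n + 1) / 2 * (f (B n) - f Bs)"
    by (simp add: b_def)
  finally have main: "V (Suc n) + L / 4 * q * (norm (B (Suc n) - A (Suc n)))\<^sup>2
    \<le> V n + \<eta> * q / 2 + l / 2 * (q / 2 * r)"
    by (simp add: V_def q_def algebra_simps)
  have "q / 2 * r \<le> 2 * (real n + 2) * W"
  proof -
    have "b - A (Suc n) = \<alpha> *\<^sub>R (b - C n)" by (simp add: A algebra_simps)
    moreover have "norm (b - C n) \<le> M" using norm_triangle_ineq4[of b "C n"] b norm_C[of n] by simp
    ultimately have 1: "(norm (b - A (Suc n)))\<^sup>2 \<le> \<alpha>\<^sup>2 * M\<^sup>2"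
      using \<alpha>' by (simp add: power_mult_distrib power_mono)
    have nA: "norm (A (Suc n)) \<le> M / 2"
      using convexD_alt[OF convex_cball[of 0 "M / 2"], of b "C n" \<alpha>] norm_C[of n] b \<alpha>'
      by (simp add: A add.commute)
    have 2: "(norm (Bs - A (Suc n)))\<^sup>2 \<le> 2 * (norm Bs)\<^sup>2 + M\<^sup>2 / 2"
    proof -
      have "(norm (Bs - A (Suc n)))\<^sup>2 \<le> (norm Bs + norm (A (Suc n)))\<^sup>2"
        by (intro power_mono norm_triangle_ineq4) auto
      also have "\<dots> \<le> 2 * (norm Bs)\<^sup>2 + 2 * (norm (A (Suc n)))\<^sup>2"
        using zero_le_power2[of "norm Bs - norm (A (Suc n))"] by (simp add: power2_eq_square algebra_simps)
      also have "(norm (A (Suc n)))\<^sup>2 \<le> (M / 2)\<^sup>2" by (intro power_mono nA) auto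
      finally show ?thesis by (simp add: power_divide)
    qed
    have 3: "q / 2 * (1 - \<alpha>) * \<alpha>\<^sup>2 \<le> (real n + 6) / 8"
    proof -
      \<comment> \<open>Clearing denominators in the claim leaves
        \<open>(n + 6) * (n + 2)^2 - 16 * n * (n + 1)\<close>, which equals this cubic.\<close>
      have "0 \<le> (real n - 2) ^ 3 + 32"
      proof (cases "n \<ge> 2")
        case False then have "n = 0 \<or> n = 1" by auto
        then show ?thesis by auto
      qed auto
      moreover have "q / 2 * (1 - \<alpha>) * \<alpha>\<^sup>2 = 2 * real n * (real n + 1) / (real n + 2)\<^sup>2"
      proof -
        have "1 - \<alpha> = real n / (real n + 2)" by (simp add: \<alpha>_def field_simps)
        then show ?thesis by (simp add: q_def \<alpha>_def power_divide divide_simps)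
      qed
      ultimately show ?thesis
        by (simp only:) (simp add: divide_simps, simp add: power2_eq_square power3_eq_cube algebra_simps)
    qed
    have 4: "q / 2 * \<alpha> = real n + 1" by (simp add: q_def \<alpha>_def)
    have "q / 2 * r = q / 2 * (1 - \<alpha>) * (norm (b - A (Suc n)))\<^sup>2 + q / 2 * \<alpha> * (norm (Bs - A (Suc n)))\<^sup>2"
      by (simp add: r_def field_simps)
    also have "\<dots> \<le> q / 2 * (1 - \<alpha>) * (\<alpha>\<^sup>2 * M\<^sup>2) + q / 2 * \<alpha> * (2 * (norm Bs)\<^sup>2 + M\<^sup>2 / 2)"
      using q \<alpha>' by (intro add_mono mult_left_mono 1 2) auto
    also have "\<dots> = (q / 2 * (1 - \<alpha>) * \<alpha>\<^sup>2) * M\<^sup>2 + (real n + 1) * (2 * (norm Bs)\<^sup>2 + M\<^sup>2 / 2)"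
      unfolding 4 by simp
    also have "\<dots> \<le> (real n + 6) / 8 * M\<^sup>2 + (real n + 1) * (2 * (norm Bs)\<^sup>2 + M\<^sup>2 / 2)"
      by (intro add_right_mono mult_right_mono 3) auto
    \<comment> \<open>The coefficients of \<open>M\<^sup>2\<close> add up to
      \<open>(n + 6) / 8 + (n + 1) / 2 = 5 * (n + 2) / 8\<close>, the origin of
      \<open>5 / 16\<close> in \<open>W\<close>.\<close>
    also have "\<dots> \<le> 2 * (real n + 2) * W"
      by (simp add: W_def field_simps)
    finally show ?thesis .
  qed
  then have "l / 2 * (q / 2 * r) \<le> l / 2 * (2 * (real n + 2) * W)" using l by (intro mult_left_mono) auto
  also have "\<dots> = l * (real n + 2) * W" by simp
  finally show ?thesis using main unfolding q_def by (simp only: mult.assoc)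
qed

text \<open>Summation of \<open>V_Suc\<close> over \<open>n < k\<close>: the sum of
  \<open>(n + 1) * (n + 2)\<close> is \<open>k * (k + 1) * (k + 2) / 3\<close> and that of
  \<open>n + 2\<close> is \<open>k * (k + 3) / 2\<close>. Minimality of \<open>f Bs\<close> gives
  \<open>V k \<ge> 0\<close>.\<close>

lemma convergence:
  assumes "k \<ge> 1"
  shows "(MIN i\<in>{1..k}. (norm ((1 / step_beta L i) *\<^sub>R (B i - A i)))\<^sup>2)
    \<le> 96 * L\<^sup>2 / (real k * (real k + 1) * (real k + 2)) * (norm (C 0 - Bs))\<^sup>2
      + 24 * L * l / real k * ((norm Bs)\<^sup>2 + 5 * M\<^sup>2 / 16) + 8 * L * \<eta>"
proof -
  define m where "m = (MIN i\<in>{1..k}. (norm ((1 / step_beta L i) *\<^sub>R (B i - A i)))\<^sup>2)"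
  have m: "m \<le> 4 * L\<^sup>2 * (norm (B i - A i))\<^sup>2" if "i \<in> {1..k}" for i
  proof -
    have "m \<le> (norm ((1 / step_beta L i) *\<^sub>R (B i - A i)))\<^sup>2"
      unfolding m_def using that by (intro Min_le) auto
    then show ?thesis using L by (simp add: step_beta_def power_mult_distrib)
  qed
  have "V n + m / (48 * L) * (real n * (real n + 1) * (real n + 2))
     \<le> V 0 + \<eta> * (real n * (real n + 1) * (real n + 2)) / 6 + l * (real n * (real n + 3) / 2) * W"
    if "n \<le> k" for n
    using that
  proof (induction n)
    case (Suc n)
    \<comment> \<open>Since \<open>1 / step_beta L i\<close> is \<open>2 * L\<close>, the minimum
      \<open>m\<close> is at most \<open>4 * L\<^sup>2\<close> times each squared step.\<close>
    have "m / (16 * L) \<le> L / 4 * (norm (B (Suc n) - A (Suc n)))\<^sup>2"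
      using m[of "Suc n"] Suc.prems L by (simp add: field_simps power2_eq_square)
    then have "m / (16 * L) * ((real n + 1) * (real n + 2))
        \<le> L / 4 * (norm (B (Suc n) - A (Suc n)))\<^sup>2 * ((real n + 1) * (real n + 2))"
      by (intro mult_right_mono) auto
    with V_Suc[of n] Suc.IH Suc.prems
    have "V (Suc n) + m / (48 * L) * (real n * (real n + 1) * (real n + 2))
        + m / (16 * L) * ((real n + 1) * (real n + 2))
      \<le> V 0 + \<eta> * (real n * (real n + 1) * (real n + 2)) / 6 + l * (real n * (real n + 3) / 2) * W
        + \<eta> * (real n + 1) * (real n + 2) / 2 + l * (real n + 2) * W"
      by (simp only: mult_ac) linarith
    moreover have "m / (48 * L) * (real n * (real n + 1) * (real n + 2))
        + m / (16 * L) * ((real n + 1) * (real n + 2))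
      = m / (48 * L) * (real (Suc n) * (real (Suc n) + 1) * (real (Suc n) + 2))"
      using L by (simp add: field_simps)
    moreover have "\<eta> * (real n * (real n + 1) * (real n + 2)) / 6 + \<eta> * (real n + 1) * (real n + 2) / 2
      = \<eta> * (real (Suc n) * (real (Suc n) + 1) * (real (Suc n) + 2)) / 6"
      by (simp add: field_simps)
    moreover have "l * (real n * (real n + 3) / 2) * W + l * (real n + 2) * W
      = l * (real (Suc n) * (real (Suc n) + 3) / 2) * W"
      by (simp add: field_simps)
    ultimately show ?case by linarith
  qed simp
  from this[of k] have bound: "V k + m / (48 * L) * (real k * (real k + 1) * (real k + 2))
     \<le> V 0 + \<eta> * (real k * (real k + 1) * (real k + 2)) / 6 + l * (real k * (real k + 3) / 2) * W"
    by simp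
  have "V k \<ge> 0" using min[of "B k"] L by (simp add: V_def)
  moreover have "V 0 = 2 * L * (norm (C 0 - Bs))\<^sup>2" by (simp add: V_def)
  \<comment> \<open>Weakening \<open>k * (k + 3)\<close> to \<open>(k + 1) * (k + 2)\<close> lets
    this factor cancel against \<open>Q\<close>, leaving \<open>1 / k\<close>.\<close>
  moreover have "l * (real k * (real k + 3) / 2) * W \<le> l * ((real k + 1) * (real k + 2) / 2) * W"
    using l by (intro mult_right_mono mult_left_mono) (auto simp: W_def algebra_simps)
  ultimately have "m / (48 * L) * (real k * (real k + 1) * (real k + 2))
     \<le> 2 * L * (norm (C 0 - Bs))\<^sup>2 + \<eta> * (real k * (real k + 1) * (real k + 2)) / 6
       + l * ((real k + 1) * (real k + 2) / 2) * W"
    using bound by linarith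
  define Q where "Q = real k * (real k + 1) * (real k + 2)"
  have Q: "Q > 0" using assms by (simp add: Q_def)
  have "m = 48 * L / Q * (m / (48 * L) * Q)" using Q L by simp
  also have "\<dots> \<le> 48 * L / Q * (2 * L * (norm (C 0 - Bs))\<^sup>2 + \<eta> * Q / 6
       + l * ((real k + 1) * (real k + 2) / 2) * W)"
    using \<open>m / (48 * L) * (real k * _ * _) \<le> _\<close> Q L by (intro mult_left_mono) (auto simp: Q_def)
  also have "\<dots> = 96 * L\<^sup>2 / Q * (norm (C 0 - Bs))\<^sup>2 + 8 * L * \<eta>
       + (48 * L / Q) * (l * ((real k + 1) * (real k + 2) / 2) * W)"
    using Q by (simp add: field_simps power2_eq_square)
  also have "(48 * L / Q) * (l * ((real k + 1) * (real k + 2) / 2) * W) = 24 * L * l / real k * W"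
    using assms by (simp add: Q_def divide_simps)
  finally show ?thesis by (simp add: m_def Q_def W_def)
qed

end

subsection \<open>Entropic transport between finitely supported measures\<close>

lemma has_bochner_integral_finite_support:
  fixes f :: "'a \<Rightarrow> real"
  assumes "finite_measure N" "finite Z" "\<And>z. z \<in> Z \<Longrightarrow> {z} \<in> sets N" "AE z in N. z \<in> Z"
    and [measurable]: "f \<in> borel_measurable N"
  shows "has_bochner_integral N f (\<Sum>z\<in>Z. f z * measure N {z})"
proof -
  interpret finite_measure N by fact
  have *: "has_bochner_integral N (\<lambda>w. \<Sum>z\<in>Z. f z * indicator {z} w) (\<Sum>z\<in>Z. f z * measure N {z})"
    using assms(3)
    by (intro has_bochner_integral_sum has_bochner_integral_mult_right has_bochner_integral_real_indicator)
       (auto simp: emeasure_finite less_top[symmetric])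
  show ?thesis
  proof (rule has_bochner_integralI_AE[OF *])
    show "AE w in N. (\<Sum>z\<in>Z. f z * indicator {z} w) = f w"
      using assms(4)
    proof eventually_elim
      case (elim w)
      then have "(\<Sum>z\<in>Z. f z * indicator {z} w) = (\<Sum>z\<in>{w}. f z * indicator {z} w)"
        using assms(2) by (intro sum.mono_neutral_right) auto
      then show ?case by simp
    qed
  qed measurable
qed

lemma emeasure_discrete_measure_singleton:
  fixes x :: "'n::finite \<Rightarrow> 'a::t1_space"
  assumes "inj x"
  shows "emeasure (discrete_measure a x) {x i} = ennreal (a i)"
proof -
  have "emeasure (discrete_measure a x) {x i} = (\<Sum>j\<in>UNIV. if j = i then ennreal (a i) else 0)"
    using assms by (subst emeasure_discrete_measure) (auto simp: inj_eq intro!: sum.cong)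
  then show ?thesis by simp
qed

lemma prob_space_discrete_measure:
  assumes "\<And>i. a i \<ge> 0" "(\<Sum>i\<in>UNIV. a i) = 1"
  shows "prob_space (discrete_measure a x)"
  by (rule prob_spaceI) (use assms in \<open>simp add: emeasure_discrete_measure sum_ennreal\<close>)

lemma AE_discrete_measure:
  fixes x :: "'n::finite \<Rightarrow> 'a::t1_space"
  shows "AE u in discrete_measure a x. u \<in> range x"
proof (rule AE_I')
  have "- range x \<in> sets borel" by (intro borel_comp borel_closed finite_imp_closed) simp
  then show "- range x \<in> null_sets (discrete_measure a x)"
    by (simp add: null_sets_def emeasure_discrete_measure)
qed auto

section \<open>The entropy of one cell and outer products\<close>

text \<open>The contribution to the Kullback-Leibler divergence of a cell of mass \<open>p\<close>
  with reference mass \<open>r\<close>. The leading factor gives the usual value 0 at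
  \<open>p = 0\<close>.\<close>

definition entropy_term :: "real \<Rightarrow> real \<Rightarrow> real" where
  "entropy_term r p = p * ln (p / r)"

text \<open>Strictness comes from \<open>s * ln (s / m) > s - m\<close> for
  \<open>s \<noteq> m\<close>, a form of \<open>ln z < z - 1\<close>. Taking \<open>m\<close> as the
  midpoint and adding the cases \<open>s = p\<close> and \<open>s = q\<close> cancels the right-hand
  sides.\<close>

lemma entropy_term_midpoint:
  assumes "r > 0" "p \<ge> 0" "q \<ge> 0"
  shows "2 * entropy_term r ((p + q) / 2) \<le> entropy_term r p + entropy_term r q"
    and "p \<noteq> q \<Longrightarrow> 2 * entropy_term r ((p + q) / 2) < entropy_term r p + entropy_term r q"
proof -
  have strict: "2 * entropy_term r ((p + q) / 2) < entropy_term r p + entropy_term r q" if "p \<noteq> q"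
  proof -
    define m where "m = (p + q) / 2"
    have m: "m > 0" using that assms by (simp add: m_def)
    have *: "s - m < s * ln (s / r) - s * ln (m / r)" if "s \<ge> 0" "s \<noteq> m" for s
    proof (cases "s = 0")
      case False
      then have s: "s > 0" using that by simp
      have "ln (m / s) < m / s - 1"
        using ln_le_minus_one[of "m / s"] ln_eq_minus_one[of "m / s"] s m that
        by (cases "ln (m / s) = m / s - 1") (auto simp: field_simps)
      then have "s * ln (m / s) < m - s"
        using mult_strict_left_mono[OF _ s, of "ln (m / s)" "m / s - 1"] s by (simp add: field_simps)
      then show ?thesis using s m assms(1) by (simp add: ln_div algebra_simps)
    qed (use m in simp)
    have "p \<noteq> m" "q \<noteq> m" using that by (auto simp: m_def)
    then have "p - m + (q - m) < (p * ln (p / r) - p * ln (m / r)) + (q * ln (q / r) - q * ln (m / r))"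
      using * assms by (intro add_strict_mono) auto
    also have "\<dots> = p * ln (p / r) + q * ln (q / r) - 2 * (m * ln (m / r))"
      by (simp add: m_def field_simps)
    finally show ?thesis by (simp add: m_def entropy_term_def)
  qed
  then show "p \<noteq> q \<Longrightarrow> 2 * entropy_term r ((p + q) / 2) < entropy_term r p + entropy_term r q" .
  show "2 * entropy_term r ((p + q) / 2) \<le> entropy_term r p + entropy_term r q"
    using strict by (cases "p = q") auto
qed

text \<open>The delicate point is 0, where plans may have entries; there
  \<open>p * ln (p / r)\<close> tends to 0.\<close>

lemma continuous_on_entropy_term:
  assumes "r > 0"
  shows "continuous_on {0..} (entropy_term r)"
  unfolding continuous_on_eq_continuous_within
proof
  fix t :: real assume "t \<in> {0..}"
  show "continuous (at t within {0..}) (entropy_term r)"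
  proof (cases "t = 0")
    case True
    have "(entropy_term r \<longlongrightarrow> 0) (at_right 0)"
      unfolding entropy_term_def using assms by real_asymp
    then show ?thesis by (simp add: True continuous_within entropy_term_def at_within_Ici_at_right)
  next
    case False
    then have "isCont (entropy_term r) t"
      unfolding entropy_term_def[abs_def] using assms by (intro continuous_intros) auto
    then show ?thesis by (rule continuous_at_imp_continuous_within)
  qed
qed

lemma inner_outer_product: "A \<bullet> outer_product u v = u \<bullet> (A *v v)"
  by (simp add: outer_product_def inner_vec_def matrix_vector_mult_def sum_distrib_left mult_ac)

lemma norm_outer_product: "norm (outer_product u v) = norm u * norm v"
proof -
  have "(norm (outer_product u v))\<^sup>2 = (norm u * norm v)\<^sup>2"
    by (simp add: power2_norm_eq_inner power_mult_distrib inner_vec_def outer_product_def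
        sum_product) (simp add: mult_ac)
  then show ?thesis by (simp add: power2_eq_iff_nonneg)
qed

text \<open>The cross-moment matrix of a plan, that is, the integral of the outer product of the two
  coordinates.\<close>

definition plan_barycenter :: "('n0::finite \<Rightarrow> real ^ 'd0) \<Rightarrow> ('n1::finite \<Rightarrow> real ^ 'd1) \<Rightarrow>
    real ^ 'n1 ^ 'n0 \<Rightarrow> real ^ 'd1 ^ 'd0" where
  "plan_barycenter x y P = (\<Sum>i\<in>UNIV. \<Sum>j\<in>UNIV. P $ i $ j *\<^sub>R outer_product (x i) (y j))"

definition transport_polytope :: "('n0::finite \<Rightarrow> real) \<Rightarrow> ('n1::finite \<Rightarrow> real) \<Rightarrow> (real ^ 'n1 ^ 'n0) set" where
  "transport_polytope a b = {P. (\<forall>i j. P $ i $ j \<ge> 0) \<and> (\<forall>i. (\<Sum>j\<in>UNIV. P $ i $ j) = a i) \<and>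
     (\<forall>j. (\<Sum>i\<in>UNIV. P $ i $ j) = b j)}"

section \<open>Couplings of finitely supported measures as matrices\<close>

locale discrete_marginals =
  fixes x :: "'n0::finite \<Rightarrow> real ^ 'd0" and y :: "'n1::finite \<Rightarrow> real ^ 'd1"
    and a :: "'n0 \<Rightarrow> real" and b :: "'n1 \<Rightarrow> real" and \<epsilon> :: real
  assumes inj_x: "inj x" and a_nonneg: "\<And>i. a i \<ge> 0" and sum_a: "(\<Sum>i\<in>UNIV. a i) = 1"
    and inj_y: "inj y" and b_nonneg: "\<And>j. b j \<ge> 0" and sum_b: "(\<Sum>j\<in>UNIV. b j) = 1"
    and \<epsilon>_pos: "\<epsilon> > 0"
begin

abbreviation "\<mu> \<equiv> discrete_measure a x"
abbreviation "\<nu> \<equiv> discrete_measure b y"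

sublocale \<mu>: prob_space \<mu> by (rule prob_space_discrete_measure[OF a_nonneg sum_a])
sublocale \<nu>: prob_space \<nu> by (rule prob_space_discrete_measure[OF b_nonneg sum_b])
sublocale \<mu>\<nu>: pair_prob_space \<mu> \<nu> ..

lemma sets_product [measurable_cong]: "sets (\<mu> \<Otimes>\<^sub>M \<nu>) = sets borel"
  by (metis borel_prod sets_discrete_measure sets_pair_measure_cong)

lemma emeasure_product_singleton: "emeasure (\<mu> \<Otimes>\<^sub>M \<nu>) {(x i, y j)} = ennreal (a i * b j)"
proof -
  have "emeasure (\<mu> \<Otimes>\<^sub>M \<nu>) ({x i} \<times> {y j}) = ennreal (a i) * ennreal (b j)"
    by (subst \<nu>.emeasure_pair_measure_Times)
       (auto simp: emeasure_discrete_measure_singleton inj_x inj_y)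
  then show ?thesis using a_nonneg b_nonneg by (simp add: ennreal_mult)
qed

lemma coupling_sets:
  assumes "\<pi> \<in> couplings \<mu> \<nu>" shows "sets \<pi> = sets borel"
  using assms sets_product by (simp add: couplings_def)

lemma projections_measurable:
  assumes "sets \<pi> = sets (\<mu> \<Otimes>\<^sub>M \<nu>)"
  shows "fst \<in> measurable \<pi> \<mu>" "snd \<in> measurable \<pi> \<nu>"
  by (simp_all only: measurable_cong_sets[OF assms refl] measurable_fst measurable_snd)

lemma coupling_measurable:
  assumes "\<pi> \<in> couplings \<mu> \<nu>"
  shows "fst \<in> measurable \<pi> \<mu>" "snd \<in> measurable \<pi> \<nu>"
  using assms projections_measurable by (auto simp only: couplings_def)

lemma coupling_AE:
  assumes "\<pi> \<in> couplings \<mu> \<nu>"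
  shows "AE z in \<pi>. z \<in> range x \<times> range y"
proof -
  have "distr \<pi> \<mu> fst = \<mu>" "distr \<pi> \<nu> snd = \<nu>" using assms by (auto simp: couplings_def)
  then have "AE u in distr \<pi> \<mu> fst. u \<in> range x" "AE v in distr \<pi> \<nu> snd. v \<in> range y"
    by (simp_all only: AE_discrete_measure)
  from this(1)[THEN AE_distrD[OF coupling_measurable(1)[OF assms]]]
    this(2)[THEN AE_distrD[OF coupling_measurable(2)[OF assms]]]
  show ?thesis by eventually_elim auto
qed

lemma sum_support: "(\<Sum>z\<in>range x \<times> range y. h z) = (\<Sum>i\<in>UNIV. \<Sum>j\<in>UNIV. h (x i, y j))"
proof -
  have "(\<Sum>z\<in>range x \<times> range y. h z) = (\<Sum>u\<in>range x. \<Sum>v\<in>range y. h (u, v))"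
    by (simp add: sum.cartesian_product split_def)
  then show ?thesis by (simp add: sum.reindex inj_x inj_y)
qed

lemma coupling_integral:
  assumes "\<pi> \<in> couplings \<mu> \<nu>" "f \<in> borel_measurable borel"
  shows "has_bochner_integral \<pi> f (\<Sum>i\<in>UNIV. \<Sum>j\<in>UNIV. f (x i, y j) * coupling_matrix x y \<pi> $ i $ j)"
proof -
  interpret \<pi>: prob_space \<pi> using assms by (simp add: couplings_def)
  have "has_bochner_integral \<pi> f (\<Sum>z\<in>range x \<times> range y. f z * measure \<pi> {z})"
    using assms coupling_AE[OF assms(1)] coupling_sets[OF assms(1)]
    by (intro has_bochner_integral_finite_support \<pi>.finite_measure_axioms)
       (auto cong: measurable_cong_sets)
  then show ?thesis by (simp add: sum_support coupling_matrix_def)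
qed

text \<open>The mass of \<open>{x i}\<close> under the first marginal is an integral of an indicator
  over \<open>\<pi>\<close>, hence a finite sum in which injectivity of \<open>x\<close> isolates
  one row. Columns are treated alike.\<close>

lemma coupling_matrix_in_polytope:
  assumes "\<pi> \<in> couplings \<mu> \<nu>"
  shows "coupling_matrix x y \<pi> \<in> transport_polytope a b"
proof -
  let ?P = "coupling_matrix x y \<pi>"
  have "(\<Sum>j\<in>UNIV. ?P $ i $ j) = a i" for i
  proof -
    have "a i = measure \<mu> {x i}"
      by (simp add: measure_def emeasure_discrete_measure_singleton inj_x a_nonneg)
    also have "\<dots> = (\<integral>u. indicator {x i} u \<partial>\<mu>)" by simp
    also have "\<dots> = (\<integral>u. indicator {x i} u \<partial>distr \<pi> \<mu> fst)" using assms by (simp add: couplings_def)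
    also have "\<dots> = (\<integral>z. indicator {x i} (fst z) \<partial>\<pi>)"
      using coupling_measurable[OF assms]
      by (intro integral_distr) (simp_all add: measurable_cong_sets[OF sets_discrete_measure refl])
    also have "\<dots> = (\<Sum>k\<in>UNIV. \<Sum>j\<in>UNIV. indicator {x i} (fst (x k, y j)) * ?P $ k $ j)"
      by (intro has_bochner_integral_integral_eq coupling_integral assms)
         (simp add: borel_prod[symmetric] del: borel_prod)
    also have "\<dots> = (\<Sum>k\<in>UNIV. if k = i then \<Sum>j\<in>UNIV. ?P $ k $ j else 0)"
      by (intro sum.cong refl) (auto simp: inj_eq[OF inj_x])
    finally show ?thesis by simp
  qed
  moreover have "(\<Sum>i\<in>UNIV. ?P $ i $ j) = b j" for j
  proof -
    have "b j = measure \<nu> {y j}"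
      by (simp add: measure_def emeasure_discrete_measure_singleton inj_y b_nonneg)
    also have "\<dots> = (\<integral>u. indicator {y j} u \<partial>\<nu>)" by simp
    also have "\<dots> = (\<integral>u. indicator {y j} u \<partial>distr \<pi> \<nu> snd)" using assms by (simp add: couplings_def)
    also have "\<dots> = (\<integral>z. indicator {y j} (snd z) \<partial>\<pi>)"
      using coupling_measurable[OF assms]
      by (intro integral_distr) (simp_all add: measurable_cong_sets[OF sets_discrete_measure refl])
    also have "\<dots> = (\<Sum>i\<in>UNIV. \<Sum>k\<in>UNIV. indicator {y j} (snd (x i, y k)) * ?P $ i $ k)"
      by (intro has_bochner_integral_integral_eq coupling_integral assms)
         (simp add: borel_prod[symmetric] del: borel_prod)
    also have "\<dots> = (\<Sum>i\<in>UNIV. \<Sum>k\<in>UNIV. if k = j then ?P $ i $ k else 0)"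
      by (intro sum.cong refl) (auto simp: inj_eq[OF inj_y])
    finally show ?thesis by simp
  qed
  ultimately show ?thesis by (simp add: transport_polytope_def coupling_matrix_def)
qed

text \<open>The measure of a Borel set is the integral of its indicator, which
  \<open>coupling_integral\<close> expresses through the matrix.\<close>

lemma coupling_eqI:
  assumes "\<pi> \<in> couplings \<mu> \<nu>" "\<rho> \<in> couplings \<mu> \<nu>" "coupling_matrix x y \<pi> = coupling_matrix x y \<rho>"
  shows "\<pi> = \<rho>"
proof (rule measure_eqI)
  show "sets \<pi> = sets \<rho>" using assms coupling_sets by simp
  fix E assume "E \<in> sets \<pi>"
  then have E: "E \<in> sets borel" using coupling_sets[OF assms(1)] by simp
  have *: "measure \<sigma> E = (\<Sum>i\<in>UNIV. \<Sum>j\<in>UNIV. indicator E (x i, y j) * coupling_matrix x y \<sigma> $ i $ j)"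
    if "\<sigma> \<in> couplings \<mu> \<nu>" for \<sigma>
  proof -
    have "(\<integral>z. indicator E z \<partial>\<sigma>) = (\<Sum>i\<in>UNIV. \<Sum>j\<in>UNIV. indicator E (x i, y j) * coupling_matrix x y \<sigma> $ i $ j)"
      using E by (intro has_bochner_integral_integral_eq coupling_integral that) simp
    moreover have "E \<inter> space \<sigma> = E" using E coupling_sets[OF that] by (metis sets.Int_space_eq2)
    ultimately show ?thesis by simp
  qed
  interpret \<pi>: prob_space \<pi> using assms by (simp add: couplings_def)
  interpret \<rho>: prob_space \<rho> using assms by (simp add: couplings_def)
  show "emeasure \<pi> E = emeasure \<rho> E"
    using * assms by (simp add: \<pi>.emeasure_eq_measure \<rho>.emeasure_eq_measure)
qed

text \<open>Each entry is at most its row sum and its column sum. Weights may vanish, and this is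
  what still makes couplings absolutely continuous with respect to the product.\<close>

lemma polytope_zero:
  assumes "P \<in> transport_polytope a b" "a i * b j = 0" shows "P $ i $ j = 0"
proof -
  have nn: "P $ i' $ j' \<ge> 0" for i' j' using assms by (simp add: transport_polytope_def)
  have "P $ i $ j \<le> a i"
    using assms nn member_le_sum[of j UNIV "\<lambda>j. P $ i $ j"] by (simp add: transport_polytope_def)
  moreover have "P $ i $ j \<le> b j"
    using assms nn member_le_sum[of i UNIV "\<lambda>i. P $ i $ j"] by (simp add: transport_polytope_def)
  ultimately show ?thesis using assms(2) nn[of i j] by auto
qed

lemma coupling_KL:
  assumes "\<pi> \<in> couplings \<mu> \<nu>"
  shows "KL \<pi> (\<mu> \<Otimes>\<^sub>M \<nu>) =
    ereal (\<Sum>i\<in>UNIV. \<Sum>j\<in>UNIV. entropy_term (a i * b j) (coupling_matrix x y \<pi> $ i $ j))"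
proof -
  interpret \<pi>: prob_space \<pi> using assms by (simp add: couplings_def)
  let ?P = "coupling_matrix x y \<pi>" and ?R = "\<mu> \<Otimes>\<^sub>M \<nu>"
  have P: "?P \<in> transport_polytope a b" by (rule coupling_matrix_in_polytope[OF assms])
  have sets: "sets \<pi> = sets ?R" using assms by (simp add: couplings_def)
  have em: "emeasure \<pi> {(x i, y j)} = ennreal (?P $ i $ j)" for i j
    by (simp add: \<pi>.emeasure_eq_measure coupling_matrix_def)
  have ac: "absolutely_continuous ?R \<pi>"
    unfolding absolutely_continuous_def
  proof
    fix E assume E: "E \<in> null_sets ?R"
    \<comment> \<open>A null set of the product meets the grid only in cells of reference mass 0,
      and these carry no mass under \<open>\<pi>\<close>.\<close>
    have zero: "{z} \<in> null_sets \<pi>" if "z \<in> E \<inter> range x \<times> range y" for z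
    proof -
      from that obtain i j where z: "z = (x i, y j)" "(x i, y j) \<in> E" by auto
      have "emeasure ?R {(x i, y j)} \<le> emeasure ?R E"
        using z E by (intro emeasure_mono) auto
      then have "a i * b j = 0"
        using E a_nonneg[of i] b_nonneg[of j]
        by (simp add: emeasure_product_singleton null_sets_def ennreal_eq_0_iff mult_le_0_iff) linarith
      then show ?thesis
        using polytope_zero[OF P] em[of i j] coupling_sets[OF assms] by (simp add: z null_sets_def)
    qed
    have "AE z in \<pi>. z \<notin> (\<Union>z\<in>E \<inter> range x \<times> range y. {z})"
      using zero by (intro AE_not_in null_sets.finite_UN) auto
    then have "AE z in \<pi>. z \<notin> E"
      using coupling_AE[OF assms] by eventually_elim blast
    moreover have "E \<in> sets \<pi>" unfolding sets by (rule null_setsD2[OF E])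
    ultimately show "E \<in> null_sets \<pi>" using AE_iff_null_sets by blast
  qed
  have meas: "entropy_density (exp 1) ?R \<pi> \<in> borel_measurable borel"
    using measurable_entropy_density[of "exp 1" ?R \<pi>] sets_product by (simp cong: measurable_cong_sets)
  have "entropy_density (exp 1) ?R \<pi> (x i, y j) * ?P $ i $ j = entropy_term (a i * b j) (?P $ i $ j)" for i j
  proof (cases "?P $ i $ j = 0")
    case False
    then have ab: "a i * b j > 0"
      using polytope_zero[OF P, of i j] a_nonneg[of i] b_nonneg[of j] by (auto simp: less_le)
    have "{(x i, y j)} \<in> sets ?R" unfolding sets_product by simp
    \<comment> \<open>At an atom the Radon-Nikodym derivative is the ratio of the two
      masses.\<close>
    then have "ennreal (?P $ i $ j) = RN_deriv ?R \<pi> (x i, y j) * ennreal (a i * b j)"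
      using \<mu>\<nu>.RN_deriv_singleton[OF ac sets, of "(x i, y j)"]
      by (simp only: em emeasure_product_singleton)
    then have "?P $ i $ j = enn2real (RN_deriv ?R \<pi> (x i, y j)) * (a i * b j)"
    proof -
      have "enn2real (ennreal (?P $ i $ j)) = ?P $ i $ j" by (simp add: coupling_matrix_def)
      then show ?thesis using \<open>ennreal (?P $ i $ j) = _\<close> ab by (simp add: enn2real_mult)
    qed
    then have "enn2real (RN_deriv ?R \<pi> (x i, y j)) = ?P $ i $ j / (a i * b j)"
      using ab by (subst nonzero_eq_divide_eq) auto
    then show ?thesis by (simp add: entropy_density_def entropy_term_def log_def)
  qed (simp add: entropy_term_def)
  then have "has_bochner_integral \<pi> (entropy_density (exp 1) ?R \<pi>)
      (\<Sum>i\<in>UNIV. \<Sum>j\<in>UNIV. entropy_term (a i * b j) (?P $ i $ j))"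
    using coupling_integral[OF assms meas] by simp
  then show ?thesis
    using ac by (simp add: KL_def KL_divergence_def has_bochner_integral_iff)
qed

section \<open>The finite-dimensional problem and its unique minimiser\<close>

definition plan_cost :: "real ^ 'd1 ^ 'd0 \<Rightarrow> real ^ 'n1 ^ 'n0 \<Rightarrow> real" where
  "plan_cost X P = (\<Sum>i\<in>UNIV. \<Sum>j\<in>UNIV. cost X (x i) (y j) * P $ i $ j)
     + \<epsilon> * (\<Sum>i\<in>UNIV. \<Sum>j\<in>UNIV. entropy_term (a i * b j) (P $ i $ j))"

lemma eot_objective_coupling:
  assumes "\<pi> \<in> couplings \<mu> \<nu>"
  shows "eot_objective X \<epsilon> \<mu> \<nu> \<pi> = ereal (plan_cost X (coupling_matrix x y \<pi>))"
proof -
  have "(\<lambda>(u, v). cost X u v) \<in> borel_measurable borel"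
    unfolding cost_def by (intro borel_measurable_continuous_onI)
      (auto simp: case_prod_beta intro!: continuous_intros
        linear_continuous_on_compose[OF continuous_on_snd matrix_vector_mul_linear])
  from has_bochner_integral_integral_eq[OF coupling_integral[OF assms this]]
  show ?thesis by (simp add: eot_objective_def coupling_KL[OF assms] plan_cost_def)
qed

text \<open>The entropy and the norm term of the cost cancel; the bilinear term is linear in the
  matrix, by \<open>inner_outer_product\<close>.\<close>

lemma plan_cost_shift:
  "plan_cost Y P = plan_cost X P - 32 * ((Y - X) \<bullet> plan_barycenter x y P)"
  by (simp add: plan_cost_def plan_barycenter_def cost_def inner_sum_right inner_outer_product
      matrix_vector_mult_diff_rdistrib inner_diff_right sum_subtractf sum_distrib_left algebra_simps)

text \<open>The witness places mass \<open>P $ i $ j\<close> at \<open>(x i, y j)\<close>, as a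
  discrete measure indexed by pairs.\<close>

lemma ex_coupling:
  assumes "P \<in> transport_polytope a b"
  shows "\<exists>\<pi>\<in>couplings \<mu> \<nu>. coupling_matrix x y \<pi> = P"
proof -
  have nn: "P $ i $ j \<ge> 0" and row: "(\<Sum>j\<in>UNIV. P $ i $ j) = a i"
    and col: "(\<Sum>i\<in>UNIV. P $ i $ j) = b j" for i j
    using assms by (auto simp: transport_polytope_def)
  define w where "w = (\<lambda>(i, j). P $ i $ j)"
  define z where "z = (\<lambda>(i, j). (x i, y j))"
  define \<pi> where "\<pi> = discrete_measure w z"
  have z: "inj z" using inj_x inj_y by (auto simp: z_def inj_on_def)
  have w: "w ij \<ge> 0" for ij by (cases ij) (simp add: w_def nn)
  have sum_ij: "(\<Sum>ij\<in>UNIV. h ij) = (\<Sum>i\<in>UNIV. \<Sum>j\<in>UNIV. h (i, j))" for h :: "'n0 \<times> 'n1 \<Rightarrow> 'c::comm_monoid_add"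
    by (simp add: sum.cartesian_product flip: UNIV_Times_UNIV)
  have "prob_space \<pi>"
    unfolding \<pi>_def using w by (intro prob_space_discrete_measure) (auto simp: sum_ij w_def row sum_a)
  moreover have sets: "sets \<pi> = sets (\<mu> \<Otimes>\<^sub>M \<nu>)" using sets_product by (simp add: \<pi>_def)
  moreover have "distr \<pi> \<mu> fst = \<mu>"
  proof (rule measure_eqI)
    fix S assume "S \<in> sets (distr \<pi> \<mu> fst)"
    then have S: "S \<in> sets \<mu>" by (simp only: sets_distr)
    have "emeasure (distr \<pi> \<mu> fst) S = emeasure \<pi> (fst -` S)"
      using emeasure_distr[OF projections_measurable(1)[OF sets] S] by (simp add: \<pi>_def)
    also have "\<dots> = (\<Sum>i\<in>UNIV. \<Sum>j\<in>UNIV. ennreal (P $ i $ j) * indicator S (x i))"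
      using measurable_sets[OF projections_measurable(1)[OF sets] S]
      by (simp add: \<pi>_def emeasure_discrete_measure sum_ij w_def z_def indicator_def)
    also have "\<dots> = (\<Sum>i\<in>UNIV. ennreal (a i) * indicator S (x i))"
      by (simp add: sum_distrib_right[symmetric] sum_ennreal nn row)
    also have "\<dots> = emeasure \<mu> S"
      using S by (subst emeasure_discrete_measure) simp_all
    finally show "emeasure (distr \<pi> \<mu> fst) S = emeasure \<mu> S" .
  qed simp
  moreover have "distr \<pi> \<nu> snd = \<nu>"
  proof (rule measure_eqI)
    fix S assume "S \<in> sets (distr \<pi> \<nu> snd)"
    then have S: "S \<in> sets \<nu>" by (simp only: sets_distr)
    have "emeasure (distr \<pi> \<nu> snd) S = emeasure \<pi> (snd -` S)"
      using emeasure_distr[OF projections_measurable(2)[OF sets] S] by (simp add: \<pi>_def)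
    also have "\<dots> = (\<Sum>i\<in>UNIV. \<Sum>j\<in>UNIV. ennreal (P $ i $ j) * indicator S (y j))"
      using measurable_sets[OF projections_measurable(2)[OF sets] S]
      by (simp add: \<pi>_def emeasure_discrete_measure sum_ij w_def z_def indicator_def)
    also have "\<dots> = (\<Sum>j\<in>UNIV. ennreal (b j) * indicator S (y j))"
      by (subst sum.swap) (simp add: sum_distrib_right[symmetric] sum_ennreal nn col)
    also have "\<dots> = emeasure \<nu> S"
      using S by (subst emeasure_discrete_measure) simp_all
    finally show "emeasure (distr \<pi> \<nu> snd) S = emeasure \<nu> S" .
  qed simp
  ultimately have "\<pi> \<in> couplings \<mu> \<nu>" unfolding couplings_def by blast
  moreover have "coupling_matrix x y \<pi> = P"
    using emeasure_discrete_measure_singleton[OF z, of w]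
    by (simp add: coupling_matrix_def \<pi>_def vec_eq_iff measure_def z_def w_def split_paired_all nn)
  ultimately show ?thesis by blast
qed

lemma compact_polytope: "compact (transport_polytope a b)"
  unfolding compact_eq_bounded_closed
proof
  have "norm P \<le> 1" if "P \<in> transport_polytope a b" for P :: "real ^ 'n1 ^ 'n0"
  proof -
    have "norm P \<le> (\<Sum>i\<in>UNIV. norm (P $ i))" unfolding norm_vec_def by (rule L2_set_le_sum) simp
    also have "\<dots> \<le> (\<Sum>i\<in>UNIV. \<Sum>j\<in>UNIV. \<bar>P $ i $ j\<bar>)" by (intro sum_mono norm_le_l1_cart)
    also have "\<dots> = 1" using that by (simp add: transport_polytope_def sum_a)
    finally show ?thesis .
  qed
  then show "bounded (transport_polytope a b :: (real ^ 'n1 ^ 'n0) set)" by (auto simp: bounded_iff)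
  show "closed (transport_polytope a b :: (real ^ 'n1 ^ 'n0) set)"
    unfolding transport_polytope_def
    by (intro closed_Collect_conj closed_Collect_all closed_Collect_le closed_Collect_eq continuous_intros)
qed

lemma product_in_polytope: "(\<chi> i j. a i * b j) \<in> transport_polytope a b"
  by (simp add: transport_polytope_def a_nonneg b_nonneg sum_a sum_b
      flip: sum_distrib_left sum_distrib_right)

lemma continuous_on_plan_cost: "continuous_on (transport_polytope a b) (plan_cost X)"
proof -
  have "continuous_on (transport_polytope a b)
      (\<lambda>P :: real ^ 'n1 ^ 'n0. entropy_term (a i * b j) (P $ i $ j))" for i j
  proof (cases "a i * b j = 0")
    case True
    \<comment> \<open>Division by zero yields 0, so the term is the entry times the constant
      \<open>ln 0\<close>.\<close>
    show ?thesis unfolding True entropy_term_def by simp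
  next
    case False
    then have "a i * b j > 0" using a_nonneg[of i] b_nonneg[of j] by (auto simp: less_le)
    then show ?thesis
      by (intro continuous_on_compose2[OF continuous_on_entropy_term] continuous_intros)
         (auto simp: transport_polytope_def)
  qed
  then show ?thesis unfolding plan_cost_def[abs_def] by (intro continuous_intros)
qed

lemma ex_optimal_plan:
  "\<exists>P\<in>transport_polytope a b. \<forall>Q\<in>transport_polytope a b. plan_cost X P \<le> plan_cost X Q"
  using continuous_attains_inf[OF compact_polytope _ continuous_on_plan_cost] product_in_polytope
  by blast

text \<open>Midpoint argument: the linear cost is additive, so optimality of \<open>P\<close> and
  \<open>Q\<close> forces the nonnegative convexity defects \<open>t i j\<close> of the entropy to
  vanish. Where \<open>a i * b j = 0\<close> both plans are 0; elsewhere strict convexity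
  applies.\<close>

lemma optimal_plan_unique:
  assumes P: "P \<in> transport_polytope a b" and Q: "Q \<in> transport_polytope a b"
    and minP: "\<And>R. R \<in> transport_polytope a b \<Longrightarrow> plan_cost X P \<le> plan_cost X R"
    and minQ: "\<And>R. R \<in> transport_polytope a b \<Longrightarrow> plan_cost X Q \<le> plan_cost X R"
  shows "P = Q"
proof -
  define R :: "real ^ 'n1 ^ 'n0" where "R = (\<chi> i j. (P $ i $ j + Q $ i $ j) / 2)"
  have R: "R \<in> transport_polytope a b"
    using P Q by (simp add: transport_polytope_def R_def sum.distrib flip: sum_divide_distrib)
  define t where "t i j = entropy_term (a i * b j) (P $ i $ j) + entropy_term (a i * b j) (Q $ i $ j)
    - 2 * entropy_term (a i * b j) (R $ i $ j)" for i j
  have lin: "(\<Sum>i\<in>UNIV. \<Sum>j\<in>UNIV. cost X (x i) (y j) * P $ i $ j)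
      + (\<Sum>i\<in>UNIV. \<Sum>j\<in>UNIV. cost X (x i) (y j) * Q $ i $ j)
    = 2 * (\<Sum>i\<in>UNIV. \<Sum>j\<in>UNIV. cost X (x i) (y j) * R $ i $ j)"
    unfolding sum_distrib_left sum.distrib[symmetric] R_def
    by (intro sum.cong refl) (simp add: algebra_simps)
  have "plan_cost X P + plan_cost X Q - 2 * plan_cost X R = \<epsilon> * (\<Sum>i\<in>UNIV. \<Sum>j\<in>UNIV. t i j)"
    using lin by (simp add: plan_cost_def t_def sum.distrib sum_subtractf sum_distrib_left[symmetric] algebra_simps)
  moreover have "plan_cost X P + plan_cost X Q - 2 * plan_cost X R \<le> 0" using minP[OF R] minQ[OF R] by simp
  ultimately have le: "(\<Sum>i\<in>UNIV. \<Sum>j\<in>UNIV. t i j) \<le> 0" using \<epsilon>_pos by (simp add: mult_le_0_iff)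
  have nn: "P $ i $ j \<ge> 0" "Q $ i $ j \<ge> 0" for i j using P Q by (auto simp: transport_polytope_def)
  have t: "0 \<le> t i j \<and> (t i j = 0 \<longrightarrow> P $ i $ j = Q $ i $ j)" for i j
  proof (cases "a i * b j = 0")
    case True
    then show ?thesis using polytope_zero[OF P True] polytope_zero[OF Q True] polytope_zero[OF R True]
      by (simp add: t_def entropy_term_def)
  next
    case False
    then have "a i * b j > 0" using a_nonneg[of i] b_nonneg[of j] by (auto simp: less_le)
    from entropy_term_midpoint[OF this nn(1)[of i j] nn(2)[of i j]]
    show ?thesis by (cases "P $ i $ j = Q $ i $ j") (simp_all add: t_def R_def)
  qed
  have "(\<Sum>i\<in>UNIV. \<Sum>j\<in>UNIV. t i j) = 0" using le t by (meson antisym sum_nonneg)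
  then have "t i j = 0" for i j using t by (simp add: sum_nonneg_eq_0_iff sum_nonneg)
  then show ?thesis using t by (simp add: vec_eq_iff)
qed

text \<open>Justifies the definite description in \<open>optimal_coupling\<close>: existence and
  uniqueness pass from matrices to measures through \<open>ex_coupling\<close> and
  \<open>coupling_eqI\<close>.\<close>

lemma is_arg_min_optimal_coupling:
  "is_arg_min (eot_objective X \<epsilon> \<mu> \<nu>) (\<lambda>\<pi>. \<pi> \<in> couplings \<mu> \<nu>) (optimal_coupling X \<epsilon> \<mu> \<nu>)"
  unfolding optimal_coupling_def
proof (rule theI')
  have *: "is_arg_min (eot_objective X \<epsilon> \<mu> \<nu>) (\<lambda>\<pi>. \<pi> \<in> couplings \<mu> \<nu>) \<pi> \<longleftrightarrow> \<pi> \<in> couplings \<mu> \<nu> \<and>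
    (\<forall>R\<in>transport_polytope a b. plan_cost X (coupling_matrix x y \<pi>) \<le> plan_cost X R)" for \<pi>
    unfolding is_arg_min_def
    by (metis (no_types, lifting) coupling_matrix_in_polytope eot_objective_coupling ereal_less_eq(3)
        ex_coupling not_less)
  obtain P where "P \<in> transport_polytope a b" "\<forall>Q\<in>transport_polytope a b. plan_cost X P \<le> plan_cost X Q"
    using ex_optimal_plan by blast
  moreover from this obtain \<pi> where "\<pi> \<in> couplings \<mu> \<nu>" "coupling_matrix x y \<pi> = P"
    using ex_coupling by blast
  ultimately show "\<exists>!\<pi>. is_arg_min (eot_objective X \<epsilon> \<mu> \<nu>) (\<lambda>\<pi>. \<pi> \<in> couplings \<mu> \<nu>) \<pi>"
    unfolding *
    by (intro ex1I[of _ \<pi>]) (auto intro!: coupling_eqI optimal_plan_unique coupling_matrix_in_polytope)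
qed

section \<open>The transport value as a function of the matrix\<close>

definition plan :: "real ^ 'd1 ^ 'd0 \<Rightarrow> real ^ 'n1 ^ 'n0" where
  "plan X = coupling_matrix x y (optimal_coupling X \<epsilon> \<mu> \<nu>)"

lemma plan_in_polytope: "plan X \<in> transport_polytope a b"
  using is_arg_min_optimal_coupling[of X] coupling_matrix_in_polytope
  by (simp add: plan_def is_arg_min_def)

lemma EOT_eq_plan_cost: "EOT X \<epsilon> \<mu> \<nu> = plan_cost X (plan X)"
proof -
  let ?f = "eot_objective X \<epsilon> \<mu> \<nu>" and ?\<pi> = "optimal_coupling X \<epsilon> \<mu> \<nu>"
  have "?\<pi> \<in> couplings \<mu> \<nu>" "\<And>\<rho>. \<rho> \<in> couplings \<mu> \<nu> \<Longrightarrow> ?f ?\<pi> \<le> ?f \<rho>"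
    using is_arg_min_optimal_coupling[of X] by (auto simp: is_arg_min_def not_less)
  then have "(INF \<rho>\<in>couplings \<mu> \<nu>. ?f \<rho>) = ?f ?\<pi>"
    by (intro antisym INF_lower INF_greatest)
  then show ?thesis
    using \<open>?\<pi> \<in> _\<close> by (simp add: EOT_def plan_def eot_objective_coupling)
qed

lemma EOT_le_plan_cost:
  assumes "P \<in> transport_polytope a b" shows "EOT X \<epsilon> \<mu> \<nu> \<le> plan_cost X P"
proof -
  obtain \<pi> where "\<pi> \<in> couplings \<mu> \<nu>" "coupling_matrix x y \<pi> = P" using ex_coupling[OF assms] by blast
  then show ?thesis
    using is_arg_min_optimal_coupling[of X]
    by (force simp: EOT_eq_plan_cost plan_def is_arg_min_def not_less eot_objective_coupling)
qed

text \<open>The plan optimal at \<open>X\<close> remains admissible at \<open>Y\<close>, and its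
  cost there follows from \<open>plan_cost_shift\<close>.\<close>

lemma EOT_supergradient:
  "EOT Y \<epsilon> \<mu> \<nu> \<le> EOT X \<epsilon> \<mu> \<nu> - 32 * ((Y - X) \<bullet> plan_barycenter x y (plan X))"
  using EOT_le_plan_cost[OF plan_in_polytope, of Y X] plan_cost_shift[of Y "plan X" X]
  by (simp add: EOT_eq_plan_cost)

lemma moment_discrete_measure:
  "moment 2 \<mu> = (\<Sum>i\<in>UNIV. (norm (x i))\<^sup>2 * a i)" "moment 2 \<nu> = (\<Sum>j\<in>UNIV. (norm (y j))\<^sup>2 * b j)"
proof -
  have "has_bochner_integral \<mu> (\<lambda>u. norm u ^ 2) (\<Sum>u\<in>range x. norm u ^ 2 * measure \<mu> {u})"
    by (intro has_bochner_integral_finite_support AE_discrete_measure \<mu>.finite_measure_axioms)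
       (auto simp: measurable_cong_sets[OF sets_discrete_measure refl])
  then show "moment 2 \<mu> = (\<Sum>i\<in>UNIV. (norm (x i))\<^sup>2 * a i)"
    by (simp add: moment_def has_bochner_integral_iff sum.reindex inj_x measure_def
        emeasure_discrete_measure_singleton a_nonneg)
  have "has_bochner_integral \<nu> (\<lambda>u. norm u ^ 2) (\<Sum>u\<in>range y. norm u ^ 2 * measure \<nu> {u})"
    by (intro has_bochner_integral_finite_support AE_discrete_measure \<nu>.finite_measure_axioms)
       (auto simp: measurable_cong_sets[OF sets_discrete_measure refl])
  then show "moment 2 \<nu> = (\<Sum>j\<in>UNIV. (norm (y j))\<^sup>2 * b j)"
    by (simp add: moment_def has_bochner_integral_iff sum.reindex inj_y measure_def
        emeasure_discrete_measure_singleton b_nonneg)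
qed

text \<open>Triangle inequality, then Cauchy-Schwarz over the cells with \<open>P $ i $ j\<close>
  split into two square roots. Row and column sums turn the two factors into second moments.\<close>

lemma norm_plan_barycenter_le:
  assumes "P \<in> transport_polytope a b"
  shows "norm (plan_barycenter x y P) \<le> moment_const \<mu> \<nu>"
proof -
  have nn: "P $ i $ j \<ge> 0" and row: "(\<Sum>j\<in>UNIV. P $ i $ j) = a i"
    and col: "(\<Sum>i\<in>UNIV. P $ i $ j) = b j" for i j
    using assms by (auto simp: transport_polytope_def)
  have sum_ij: "(\<Sum>ij\<in>UNIV. h ij) = (\<Sum>i\<in>UNIV. \<Sum>j\<in>UNIV. h (i, j))" for h :: "'n0 \<times> 'n1 \<Rightarrow> real"
    by (simp add: sum.cartesian_product flip: UNIV_Times_UNIV)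
  define s where "s = (\<Sum>i\<in>UNIV. \<Sum>j\<in>UNIV. P $ i $ j * (norm (x i) * norm (y j)))"
  define u where "u = (\<lambda>(i, j). sqrt (P $ i $ j) * norm (x i))"
  define v where "v = (\<lambda>(i, j). sqrt (P $ i $ j) * norm (y j))"
  have "norm (plan_barycenter x y P) \<le> s"
    unfolding plan_barycenter_def s_def
    by (intro sum_norm_le) (simp add: norm_outer_product nn)
  also have "s = (\<Sum>ij\<in>UNIV. u ij * v ij)"
    by (simp add: sum_ij s_def u_def v_def nn mult_ac flip: real_sqrt_mult)
  also have "\<dots> \<le> L2_set u UNIV * L2_set v UNIV"
    using L2_set_mult_ineq[of u v UNIV] by (simp add: u_def v_def split_def nn abs_mult)
  also have "\<dots> = moment_const \<mu> \<nu>"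
  proof -
    have "(\<Sum>ij\<in>UNIV. (u ij)\<^sup>2) = moment 2 \<mu>"
      by (simp add: sum_ij u_def power_mult_distrib nn moment_discrete_measure row
          mult.commute[of _ "a _"] flip: sum_distrib_right)
    moreover have "(\<Sum>ij\<in>UNIV. (v ij)\<^sup>2) = moment 2 \<nu>"
      by (simp add: sum_ij v_def power_mult_distrib nn moment_discrete_measure, subst sum.swap)
         (simp add: col mult.commute[of _ "b _"] flip: sum_distrib_right)
    ultimately show ?thesis by (simp add: L2_set_def moment_const_def real_sqrt_mult)
  qed
  finally show ?thesis .
qed

end

section \<open>Oracle error and the convergence bounds\<close>

lemma plan_barycenter_diff: "plan_barycenter x y (P - Q) = plan_barycenter x y P - plan_barycenter x y Q"
  by (simp add: plan_barycenter_def sum_subtractf scaleR_diff_left)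

text \<open>Meant for the difference of an oracle and the exact plan, whose entries may have either
  sign.\<close>

lemma norm_plan_barycenter_le_infnorm:
  "norm (plan_barycenter x y P) \<le> infnorm P * (\<Sum>i\<in>UNIV. \<Sum>j\<in>UNIV. norm (x i) * norm (y j))"
proof -
  have "\<bar>P $ i $ j\<bar> \<le> infnorm P" for i j
    using Basis_le_infnorm[of "axis i (axis j 1)" P] by (simp add: axis_in_Basis_iff inner_axis)
  then show ?thesis
    unfolding plan_barycenter_def sum_distrib_left
    by (intro sum_norm_le) (simp add: norm_outer_product mult_right_mono)
qed

theorem theorem11:
  fixes x :: "'n0::finite \<Rightarrow> real ^ 'd0" and y :: "'n1::finite \<Rightarrow> real ^ 'd1"
    and a :: "'n0 \<Rightarrow> real" and b :: "'n1 \<Rightarrow> real"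
    and \<mu>\<^sub>0 :: "(real ^ 'd0) measure" and \<mu>\<^sub>1 :: "(real ^ 'd1) measure"
    and \<epsilon> M L \<delta> \<delta>' :: real
    and \<Phi> :: "real ^ 'd1 ^ 'd0 \<Rightarrow> real"
    and P\<^sub>t :: "real ^ 'd1 ^ 'd0 \<Rightarrow> real ^ 'n1 ^ 'n0"
    and A B C G :: "nat \<Rightarrow> real ^ 'd1 ^ 'd0"
    and B\<^sub>s :: "real ^ 'd1 ^ 'd0"
  assumes "inj x" and "\<And>i. a i \<ge> 0" and "(\<Sum>i\<in>UNIV. a i) = 1"
    and "inj y" and "\<And>j. b j \<ge> 0" and "(\<Sum>j\<in>UNIV. b j) = 1"
    and "\<mu>\<^sub>0 = discrete_measure a x" and "\<mu>\<^sub>1 = discrete_measure b y"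
    and "\<epsilon> > 0" and "M > moment_const \<mu>\<^sub>0 \<mu>\<^sub>1"
    and "\<And>X. \<Phi> X = 32 * (norm X)\<^sup>2 + EOT X \<epsilon> \<mu>\<^sub>0 \<mu>\<^sub>1"
    and "L > 0" and "L_smooth_on L (matrix_ball M) \<Phi>"
    and "\<And>X. X \<in> matrix_ball M \<Longrightarrow>
           delta_oracle \<delta> (P\<^sub>t X) (coupling_matrix x y (optimal_coupling X \<epsilon> \<mu>\<^sub>0 \<mu>\<^sub>1))"
    and "\<And>X. \<Phi> B\<^sub>s \<le> \<Phi> X"
    and "\<delta>' = 32 * M * \<delta> * (\<Sum>i\<in>UNIV. \<Sum>j\<in>UNIV. norm (x i) * norm (y j))"
    and "C 0 \<in> matrix_ball M"
    and "adaptive_gradient_run M L (\<lambda>X. approx_gradient x y (P\<^sub>t X) X) A B C G"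
  shows "(\<forall>L'. \<not> convex_on UNIV \<Phi> \<and> L_smooth_on L' UNIV (\<lambda>X. EOT X \<epsilon> \<mu>\<^sub>0 \<mu>\<^sub>1) \<longrightarrow>
           (\<forall>k\<ge>1. (MIN i\<in>{1..k}. (norm ((1 / step_beta L i) *\<^sub>R (B i - A i)))\<^sup>2)
              \<le> 96 * L\<^sup>2 / (real k * (real k + 1) * (real k + 2)) * (norm (C 0 - B\<^sub>s))\<^sup>2
                + 24 * L * L' / real k * ((norm B\<^sub>s)\<^sup>2 + 5 * M\<^sup>2 / 16) + 8 * L * \<delta>'))
       \<and> (convex_on UNIV \<Phi> \<longrightarrow>
           (\<forall>k\<ge>1. (MIN i\<in>{1..k}. (norm ((1 / step_beta L i) *\<^sub>R (B i - A i)))\<^sup>2)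
              \<le> 96 * L\<^sup>2 / (real k * (real k + 1) * (real k + 2)) * (norm (C 0 - B\<^sub>s))\<^sup>2
                + 8 * L * \<delta>'))"
proof -
  have M: "M > 0"
    using assms(10) by (rule le_less_trans[rotated]) (simp add: moment_const_def moment_def)
  interpret discrete_marginals x y a b \<epsilon>
    by unfold_locales (fact assms)+
  have \<mu>\<^sub>0: "\<mu>\<^sub>0 = \<mu>" and \<mu>\<^sub>1: "\<mu>\<^sub>1 = \<nu>" by (fact assms)+
  have \<Phi>: "\<Phi> X = 32 * (norm X)\<^sup>2 + EOT X \<epsilon> \<mu> \<nu>" for X using assms(11) by (simp add: \<mu>\<^sub>0 \<mu>\<^sub>1)
  obtain g where g: "\<And>X. X \<in> matrix_ball M \<Longrightarrow> GDERIV \<Phi> X :> g X" and lip: "L-lipschitz_on (matrix_ball M) g"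
    using assms(13) by (auto simp: L_smooth_on_def)
  have ball: "matrix_ball M = cball 0 (M / 2)" by (auto simp: matrix_ball_def)
  have conv: "convex (matrix_ball M :: (real ^ 'd1 ^ 'd0) set)" by (simp add: ball)
  have grad_sq: "GDERIV (\<lambda>Y. 32 * (norm Y)\<^sup>2) X :> 64 *\<^sub>R X" for X :: "real ^ 'd1 ^ 'd0"
    unfolding gderiv_def power2_norm_eq_inner
    by (auto intro!: derivative_eq_intros simp: inner_commute)
  have g_eq: "g X = 64 *\<^sub>R X - 32 *\<^sub>R plan_barycenter x y (plan X)" if "X \<in> matrix_ball M" for X
  proof -
    let ?T = "plan_barycenter x y (plan X)"
    \<comment> \<open>Up to a constant, \<open>h\<close> is the transport value minus its supporting
      affine function at \<open>X\<close>, so it is maximal there.\<close>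
    define h where "h Y = \<Phi> Y - 32 * (norm Y)\<^sup>2 + 32 * (Y \<bullet> ?T)" for Y
    have "GDERIV (\<lambda>Y. 32 * (Y \<bullet> ?T)) X :> 32 *\<^sub>R ?T"
      unfolding gderiv_def by (auto intro!: derivative_eq_intros)
    then have "GDERIV h X :> g X - 64 *\<^sub>R X + 32 *\<^sub>R ?T"
      unfolding h_def by (intro GDERIV_add GDERIV_diff g that grad_sq)
    moreover have "h Y \<le> h X" for Y
      using EOT_supergradient[of Y X] by (simp add: h_def \<Phi> inner_diff_left)
    ultimately have "g X - 64 *\<^sub>R X + 32 *\<^sub>R ?T = 0" by (rule gderiv_local_max)
    then show ?thesis by (simp add: algebra_simps)
  qed
  have Bs: "norm B\<^sub>s \<le> M / 2"
  proof -
    let ?T = "plan_barycenter x y (plan B\<^sub>s)"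
    \<comment> \<open>Differentiability of \<open>\<Phi>\<close> is assumed only on the ball, where
      \<open>B\<^sub>s\<close> is not yet known to lie. The supergradient inequality and minimality
      transfer optimality to this explicit quadratic, which is differentiable everywhere.\<close>
    define h where "h Y = - (32 * (norm Y)\<^sup>2) + 32 * (Y \<bullet> ?T)" for Y
    have "GDERIV (\<lambda>Y. 32 * (Y \<bullet> ?T)) B\<^sub>s :> 32 *\<^sub>R ?T"
      unfolding gderiv_def by (auto intro!: derivative_eq_intros)
    then have "GDERIV h B\<^sub>s :> - (64 *\<^sub>R B\<^sub>s) + 32 *\<^sub>R ?T"
      unfolding h_def by (intro GDERIV_add GDERIV_minus grad_sq)
    moreover have "h Y \<le> h B\<^sub>s" for Y
      using EOT_supergradient[of Y B\<^sub>s] assms(15)[of Y] by (simp add: h_def \<Phi> inner_diff_left)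
    ultimately have "- (64 *\<^sub>R B\<^sub>s) + 32 *\<^sub>R ?T = 0" by (rule gderiv_local_max)
    then have "64 *\<^sub>R B\<^sub>s = 32 *\<^sub>R ?T" by simp
    then have "64 * norm B\<^sub>s = 32 * norm ?T" by (metis abs_numeral norm_scaleR)
    moreover have "norm ?T \<le> M"
      using norm_plan_barycenter_le[OF plan_in_polytope, of B\<^sub>s] assms(10) by (simp add: \<mu>\<^sub>0 \<mu>\<^sub>1)
    ultimately show ?thesis by simp
  qed
  have err: "norm (approx_gradient x y (P\<^sub>t X) X - g X) * M \<le> \<delta>'" if "norm X \<le> M / 2" for X
  proof -
    let ?s = "\<Sum>i\<in>UNIV. \<Sum>j\<in>UNIV. norm (x i) * norm (y j)"
    have X: "X \<in> matrix_ball M" using that by (simp add: matrix_ball_def)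
    have "infnorm (P\<^sub>t X - plan X) \<le> \<delta>"
      using assms(14)[OF X] by (simp add: delta_oracle_def plan_def \<mu>\<^sub>0 \<mu>\<^sub>1)
    then have "infnorm (P\<^sub>t X - plan X) * ?s \<le> \<delta> * ?s"
      by (intro mult_right_mono sum_nonneg) auto
    with norm_plan_barycenter_le_infnorm[of x y "P\<^sub>t X - plan X"]
    have le: "norm (plan_barycenter x y (P\<^sub>t X - plan X)) \<le> \<delta> * ?s" by linarith
    have "approx_gradient x y (P\<^sub>t X) X - g X = - (32 *\<^sub>R plan_barycenter x y (P\<^sub>t X - plan X))"
      by (simp add: approx_gradient_def g_eq[OF X] plan_barycenter_diff)
        (simp add: plan_barycenter_def algebra_simps)
    then have "norm (approx_gradient x y (P\<^sub>t X) X - g X) * M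
        = 32 * M * norm (plan_barycenter x y (P\<^sub>t X - plan X))" by simp
    also have "\<dots> \<le> 32 * M * (\<delta> * ?s)" using M by (intro mult_left_mono le) auto
    finally show ?thesis by (simp add: assms(16))
  qed
  \<comment> \<open>Both claims are instances: \<open>l = L'\<close> for the first and
    \<open>l = 0\<close> for the second.\<close>
  have bound: "(MIN i\<in>{1..k}. (norm ((1 / step_beta L i) *\<^sub>R (B i - A i)))\<^sup>2)
      \<le> 96 * L\<^sup>2 / (real k * (real k + 1) * (real k + 2)) * (norm (C 0 - B\<^sub>s))\<^sup>2
        + 24 * L * l / real k * ((norm B\<^sub>s)\<^sup>2 + 5 * M\<^sup>2 / 16) + 8 * L * \<delta>'"
    if k: "k \<ge> 1" and l: "l \<ge> 0"
      and lower: "\<And>u v. norm u \<le> M / 2 \<Longrightarrow> norm v \<le> M / 2 \<Longrightarrow>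
        \<Phi> u + g u \<bullet> (v - u) - l / 2 * (norm (v - u))\<^sup>2 \<le> \<Phi> v" for k l
  proof -
    interpret inexact_run \<Phi> g "\<lambda>X. approx_gradient x y (P\<^sub>t X) X" A B C G B\<^sub>s M L l \<delta>'
    proof unfold_locales
      fix u v :: "real ^ 'd1 ^ 'd0" assume "norm u \<le> M / 2" "norm v \<le> M / 2"
      then show "\<Phi> v \<le> \<Phi> u + g u \<bullet> (v - u) + L / 2 * (norm (v - u))\<^sup>2"
        by (intro descent_lemma[OF conv g lip]) (auto simp: matrix_ball_def)
    qed (use M l lower err Bs assms in \<open>auto simp: matrix_ball_def\<close>)
    show ?thesis using k by (rule convergence)
  qed
  have nonconvex: "(MIN i\<in>{1..k}. (norm ((1 / step_beta L i) *\<^sub>R (B i - A i)))\<^sup>2)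
      \<le> 96 * L\<^sup>2 / (real k * (real k + 1) * (real k + 2)) * (norm (C 0 - B\<^sub>s))\<^sup>2
        + 24 * L * L' / real k * ((norm B\<^sub>s)\<^sup>2 + 5 * M\<^sup>2 / 16) + 8 * L * \<delta>'"
    if smooth: "L_smooth_on L' UNIV (\<lambda>X. EOT X \<epsilon> \<mu>\<^sub>0 \<mu>\<^sub>1)" and k: "k \<ge> 1" for L' k
  proof (rule bound[OF k])
    obtain h where h: "\<And>X. GDERIV (\<lambda>X. EOT X \<epsilon> \<mu> \<nu>) X :> h X" and h_lip: "L'-lipschitz_on UNIV h"
      using smooth by (auto simp: L_smooth_on_def \<mu>\<^sub>0 \<mu>\<^sub>1)
    show "L' \<ge> 0" using h_lip by (rule lipschitz_on_nonneg)
    fix u v :: "real ^ 'd1 ^ 'd0" assume "norm u \<le> M / 2" "norm v \<le> M / 2"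
    then have u: "u \<in> matrix_ball M" by (simp add: matrix_ball_def)
    have "GDERIV \<Phi> u :> 64 *\<^sub>R u + h u"
      using GDERIV_add[OF grad_sq h, of u] by (simp add: \<Phi>[abs_def])
    \<comment> \<open>Uniqueness of derivatives identifies \<open>g\<close>, the gradient supplied
      by smoothness on the ball, with the sum of the two explicit gradients.\<close>
    then have "(\<lambda>d. d \<bullet> g u) = (\<lambda>d. d \<bullet> (64 *\<^sub>R u + h u))"
      using g[OF u] unfolding gderiv_def by (rule has_derivative_unique[rotated])
    then have gu: "g u = 64 *\<^sub>R u + h u"
      by (metis vector_eq_ldot)
    have "EOT u \<epsilon> \<mu> \<nu> + h u \<bullet> (v - u) - L' / 2 * (norm (v - u))\<^sup>2 \<le> EOT v \<epsilon> \<mu> \<nu>"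
      by (rule descent_lemma_lower[OF convex_UNIV h h_lip]) auto
    \<comment> \<open>The quadratic part is convex, so only the transport value contributes a
      curvature loss and \<open>l = L'\<close> suffices.\<close>
    moreover have "32 * (norm u)\<^sup>2 + 64 * (u \<bullet> (v - u)) \<le> 32 * (norm v)\<^sup>2"
      using zero_le_power2[of "norm (v - u)"]
      by (simp add: power2_norm_eq_inner inner_simps inner_commute)
    ultimately show "\<Phi> u + g u \<bullet> (v - u) - L' / 2 * (norm (v - u))\<^sup>2 \<le> \<Phi> v"
      by (simp add: \<Phi> gu inner_add_left)
  qed
  have convex: "(MIN i\<in>{1..k}. (norm ((1 / step_beta L i) *\<^sub>R (B i - A i)))\<^sup>2)
      \<le> 96 * L\<^sup>2 / (real k * (real k + 1) * (real k + 2)) * (norm (C 0 - B\<^sub>s))\<^sup>2 + 8 * L * \<delta>'"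
    if cvx: "convex_on UNIV \<Phi>" and k: "k \<ge> 1" for k
    using bound[OF k, of 0] convex_on_imp_above_gradient[OF cvx g] by (simp add: matrix_ball_def)
  show ?thesis using nonconvex convex by blast
qed

end
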